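(* For every integer $n\ge 2$ there are constants $c_n, C_n>0$ (depending only on $n$) such that for every integer $H\ge 2$: if $n=2$ then $c_2 H^2\le D^*_2(H)\le C_2 H^2$; if $n=3$ then $c_3 H^2\log H\le D^*_3(H)\le C_3 H^2\log H$; if $n\ge 4$ then $c_n H^{n-1}\le D^*_n(H)\le C_n H^{n-1}$.
   Context: A polynomial $f\in\mathbb{C}[X]$ is degenerate if it has two distinct roots whose quotient is a root of unity. For integers $n\ge2$, $H\ge1$, let $S^*_n(H)$ be the set of polynomials $f(X)=a_0X^n+a_1X^{n-1}+\dots+a_n\in\mathbb{Z}[X]$ with $a_0\ne 0$, $f$ degenerate, and $|a_j|\le H$ for $j=0,1,\dots,n$; let $D^*_n(H)=|S^*_n(H)|$. *)

theory Defs
  imports Complex_Main "HOL-Computational_Algebra.Polynomial"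
begin

definition root_of_unity :: "complex \<Rightarrow> bool" where
  "root_of_unity z \<longleftrightarrow> (\<exists>k::nat. k > 0 \<and> z ^ k = 1)"

(* If y = 0 then x / y = 0 in HOL, which is not a root of unity; so only quotients by
   nonzero roots count. *)
definition degenerate :: "complex poly \<Rightarrow> bool" where
  "degenerate f \<longleftrightarrow>
     (\<exists>x y. x \<noteq> y \<and> poly f x = 0 \<and> poly f y = 0 \<and> root_of_unity (x / y))"

(* The coefficient a_j of X^(n-j) is coeff f (n - j). For n >= 1, degree f = n says that f has
   the form a_0 X^n + ... + a_n with a_0 nonzero. *)
definition S_star :: "nat \<Rightarrow> nat \<Rightarrow> int poly set" where
  "S_star n H = {f. degree f = n \<and> degenerate (map_poly of_int f) \<and>
                    (\<forall>j\<le>n. \<bar>coeff f (n - j)\<bar> \<le> int H)}"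

definition D_star :: "nat \<Rightarrow> nat \<Rightarrow> nat" where
  "D_star n H = card (S_star n H)"

lemma finite_S_star: "finite (S_star n H)"
proof (rule finite_subset)
  show "S_star n H \<subseteq> Poly ` {xs. set xs \<subseteq> {- int H..int H} \<and> length xs \<le> Suc n}"
  proof
    fix f assume f: "f \<in> S_star n H"
    have b: "\<bar>coeff f i\<bar> \<le> int H" if "i \<le> n" for i
    proof -
      have "\<bar>coeff f (n - (n - i))\<bar> \<le> int H"
        using f diff_le_self[of n i] unfolding S_star_def by blast
      with that show ?thesis by simp
    qed
    have d: "degree f = n" using f by (simp add: S_star_def)
    have "set (coeffs f) \<subseteq> coeff f ` {..n}"
      using d by (auto simp: coeffs_def)
    also have "\<dots> \<subseteq> {- int H..int H}"
      using b by (force simp: abs_le_iff)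
    finally have "set (coeffs f) \<subseteq> {- int H..int H}" .
    moreover have "length (coeffs f) \<le> Suc n"
      using d by (simp add: coeffs_def)
    ultimately show "f \<in> Poly ` {xs. set xs \<subseteq> {- int H..int H} \<and> length xs \<le> Suc n}"
      by (intro image_eqI[of _ _ "coeffs f"]) auto
  qed
  show "finite (Poly ` {xs. set xs \<subseteq> {- int H..int H} \<and> length xs \<le> Suc n})"
    by (intro finite_imageI finite_lists_length_le) simp
qed

end

(* Write f = a prod (X - x_i) over the complex numbers. Quotients of roots of f have degree at
   most n^2, so a single exponent L kills all roots of unity among them, and degeneracy becomes a
   coincidence x_i^L = x_j^L.

   If the x_i^L take at most n - 2 values, the roots are zeta_i s_c(i) with L-th roots of unity
   zeta_i and at most n - 2 free numbers s_c. For each of the finitely many shapes (zeta, c) the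
   coefficient vector lies in the image of a polynomial map in n - 1 variables, and by the
   polynomial method such an image contains O(H^(n-1)) points of the integer grid of side H.

   Otherwise x_i^L = x_j^L =: t is the only coincidence. By Newton's identities prod (X - x_k^L) is
   rational, and t is its only double root, so t is rational; hence f has a quadratic factor with
   roots x_i, x_j over the integers. Its middle coefficient is determined up to O(1) choices by
   the outer ones, and heights are multiplicative up to constants, so these f number at most
   O(sum_{m << H} m (H/m)^(n-1)), which gives the three regimes.

   For the lower bounds take a X^2 + b; (a X^2 + b)(c X + d) with a, b coprime,
   max(a, b) c <= H and d <= c; and (X^2 + 1) g. *)
theory Submission
  imports Defs "HOL-Computational_Algebra.Computational_Algebra" "HOL-Library.Function_Algebras"
begin

section \<open>Integer polynomials and their complex roots\<close>

text \<open>The number of coincidences decides which tool is affordable. Treating the leading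
  coefficient and one number per value of x_i^L as free parameters discards all arithmetic
  information, and a map in k parameters yields O(H^k) points. With n - 2 values this means k = n -
  1, within the claimed size; with n - 1 values it gives only H^n, so a single coincidence has to be
  exploited through rationality: every conjugate of x_i is then a root of f with L-th power t, and
  only x_i and x_j are. If the quadratic has outer coefficients \<alpha> and \<gamma>, then x_i x_j
  = \<gamma> / \<alpha> together with x_i^L = x_j^L fixes x_i^(2L), whence the O(1) choices. The
  cofactor has n - 1 coefficients of size O(H/m), where m = max(|\<alpha>|, |\<gamma>|), and O(m)
  pairs share the same m. The summand m (H/m)^(n-1) is constant in m for n = 2, decays like 1/m for
  n = 3, and at least as fast as 1/m^2 for n >= 4. It matters that L depends on n alone, since L
  enters the number of shapes and of quadratics, hence the constants.\<close>

abbreviation cpoly :: "int poly \<Rightarrow> complex poly" where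
  "cpoly \<equiv> map_poly of_int"

lemma cpoly_add: "cpoly (p + q) = cpoly p + cpoly q"
  by (rule poly_eqI) (simp add: coeff_map_poly)

lemma cpoly_smult: "cpoly (smult c p) = smult (of_int c) (cpoly p)"
  by (rule poly_eqI) (simp add: coeff_map_poly)

lemma cpoly_mult: "cpoly (p * q) = cpoly p * cpoly q"
  by (rule poly_eqI) (simp add: coeff_map_poly coeff_mult)

lemma cpoly_pderiv: "cpoly (pderiv p) = pderiv (cpoly p)"
  by (rule poly_eqI) (simp add: coeff_map_poly coeff_pderiv)

lemma cpoly_eq_0_iff [simp]: "cpoly p = 0 \<longleftrightarrow> p = 0"
  by (auto simp: poly_eq_iff coeff_map_poly)

lemma cpoly_eq_iff: "cpoly p = cpoly q \<longleftrightarrow> p = q"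
  by (auto simp: poly_eq_iff coeff_map_poly)

lemma degree_cpoly [simp]: "degree (cpoly p) = degree p"
  by (rule degree_map_poly) auto

lemma coeff_cpoly [simp]: "coeff (cpoly p) k = of_int (coeff p k)"
  by (simp add: coeff_map_poly)

lemma common_denominator:
  fixes q :: "complex poly"
  assumes "\<And>i. coeff q i \<in> \<rat>"
  obtains d q' where "d \<noteq> 0" "smult (of_int d) q = cpoly q'"
proof -
  have "\<exists>d q'. d \<noteq> 0 \<and> smult (of_int d) q = cpoly q'"
    using assms
  proof (induction q)
    case 0
    show ?case by (intro exI[of _ 1] exI[of _ 0]) simp
  next
    case (pCons a q)
    from pCons.prems[of "Suc _"] pCons.IH
    obtain d q' where d: "d \<noteq> 0" "smult (of_int d) q = cpoly q'" by auto
    from pCons.prems[of 0] have "a \<in> \<rat>" by simp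
    then obtain m n :: int where mn: "n \<noteq> 0" "a = of_int m / of_int n"
      by (cases rule: Rats_cases') (metis less_irrefl)
    have "smult (of_int (n * d)) (pCons a q) = cpoly (pCons (m * d) (smult n q'))"
      using d mn by (simp add: map_poly_pCons cpoly_smult flip: smult_smult)
    then show ?case using d mn by (intro exI[of _ "n * d"] exI[of _ "pCons (m * d) (smult n q')"]) auto
  qed
  then show thesis using that by blast
qed

text \<open>Gauss's lemma: contents are multiplicative, so in c * g = p * q with p primitive the
  whole factor c divides the content of q and can be cancelled there.\<close>

lemma primitive_dvd_smult_cancel:
  fixes p g :: "int poly"
  assumes "content p = 1" "c \<noteq> 0" "p dvd smult c g"
  shows "p dvd g"
proof -
  from assms(3) obtain q where q: "smult c g = p * q" by (elim dvdE)
  have "\<bar>c\<bar> * content g = content q"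
    using arg_cong[OF q, of content] assms(1) by (simp add: content_mult)
  then have "c dvd content q" by (metis abs_dvd_iff dvd_triv_left)
  then have "[:c:] dvd q" by (simp add: const_poly_dvd_iff_dvd_content)
  then obtain r where "q = smult c r" by (auto elim!: dvdE)
  then have "smult c g = smult c (p * r)" using q by simp
  then have "g = p * r" using assms(2) by (metis smult_cancel)
  then show ?thesis by simp
qed

text \<open>The witness is the primitive part of an integer annihilator of least degree.
  Pseudo-division by it leaves a remainder of smaller degree that also vanishes at \<alpha>, hence
  is 0, and the scaling by a power of the leading coefficient is cancelled by Gauss's lemma. The
  derivative cannot vanish at \<alpha>, having smaller degree. Divisibility is stated twice: over
  the integers to obtain integer factors of f, and for rational coefficients to treat polynomials
  such as X^L - t.\<close>

lemma int_minimal_poly: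
  fixes \<alpha> :: complex
  assumes "algebraic \<alpha>"
  obtains p :: "int poly" where
    "p \<noteq> 0" "poly (cpoly p) \<alpha> = 0" "poly (pderiv (cpoly p)) \<alpha> \<noteq> 0"
    "\<And>g. poly (cpoly g) \<alpha> = 0 \<Longrightarrow> p dvd g"
    "\<And>g. (\<And>i. coeff g i \<in> \<rat>) \<Longrightarrow> poly g \<alpha> = 0 \<Longrightarrow> cpoly p dvd g"
proof -
  let ?Q = "\<lambda>p. p \<noteq> 0 \<and> poly (cpoly p) \<alpha> = 0"
  from algebraicE'[OF assms] obtain p0 where "?Q p0" by blast
  then obtain p1 where p1: "?Q p1" and min1: "\<And>q. ?Q q \<Longrightarrow> degree p1 \<le> degree q"
    using ex_has_least_nat[of ?Q p0 degree] by blast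
  define p where "p = primitive_part p1"
  have p1_eq: "p1 = smult (content p1) p" by (simp add: p_def)
  have "p \<noteq> 0" using p1 by (simp add: p_def)
  have "content p = 1" using p1 by (simp add: p_def)
  have root: "poly (cpoly p) \<alpha> = 0"
    using p1 arg_cong[OF p1_eq, of "\<lambda>h. poly (cpoly h) \<alpha>"]
    by (auto simp: cpoly_smult)
  have min: "degree p \<le> degree q" if "?Q q" for q
    using min1[OF that] by (simp add: p_def)
  have dvd: "p dvd g" if g: "poly (cpoly g) \<alpha> = 0" for g
  proof -
    obtain q r where qr: "pseudo_divmod g p = (q, r)" by force
    define c where "c = coeff p (degree p) ^ (Suc (degree g) - degree p)"
    from pseudo_divmod[OF \<open>p \<noteq> 0\<close> qr] have eq: "smult c g = p * q + r"
      and r: "r = 0 \<or> degree r < degree p" by (simp_all add: c_def)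
    have "poly (cpoly r) \<alpha> = 0"
      using arg_cong[OF eq, of "\<lambda>h. poly (cpoly h) \<alpha>"] g root
      by (simp add: cpoly_add cpoly_mult cpoly_smult)
    then have "r = 0" using r min[of r] by linarith
    then have "p dvd smult c g" using eq by simp
    moreover have "c \<noteq> 0" using \<open>p \<noteq> 0\<close> by (simp add: c_def)
    ultimately show ?thesis using primitive_dvd_smult_cancel \<open>content p = 1\<close> by blast
  qed
  have cdvd: "cpoly p dvd g" if g: "\<And>i. coeff g i \<in> \<rat>" "poly g \<alpha> = 0" for g
  proof -
    from common_denominator[OF g(1)] obtain d g' where d: "d \<noteq> 0" "smult (of_int d) g = cpoly g'"
      by blast
    have "poly (cpoly g') \<alpha> = 0" using g(2) by (simp flip: d(2))
    then obtain h where "g' = p * h" using dvd by (blast elim: dvdE)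
    then have "cpoly p dvd smult (of_int d) g" by (simp add: d(2) cpoly_mult)
    then show ?thesis using d(1) by (simp add: dvd_smult_iff)
  qed
  have "poly (pderiv (cpoly p)) \<alpha> \<noteq> 0"
  proof
    assume 0: "poly (pderiv (cpoly p)) \<alpha> = 0"
    have "degree p \<noteq> 0"
    proof
      assume "degree p = 0"
      then obtain c where "p = [:c:]" by (meson degree_eq_zeroE)
      then show False using root \<open>p \<noteq> 0\<close> by (simp add: map_poly_pCons)
    qed
    then have "pderiv p \<noteq> 0" by (simp add: pderiv_eq_0_iff)
    then have "degree p \<le> degree (pderiv p)"
      using min[of "pderiv p"] 0 by (simp add: cpoly_pderiv)
    then show False using \<open>degree p \<noteq> 0\<close> by (simp add: degree_pderiv)
  qed
  with that \<open>p \<noteq> 0\<close> root dvd cdvd show thesis by blast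
qed

section \<open>Rationality of power sums\<close>

text \<open>A list keeps multiplicities when the roots are replaced by their powers, inverses or
  products through \<open>map\<close>.\<close>

definition monic_of_roots :: "complex list \<Rightarrow> complex poly" where
  "monic_of_roots xs = (\<Prod>x\<leftarrow>xs. [:- x, 1:])"

lemma monic_of_roots_simps [simp]:
  "monic_of_roots [] = 1"
  "monic_of_roots (x # xs) = [:- x, 1:] * monic_of_roots xs"
  by (simp_all add: monic_of_roots_def)

lemma monic_of_roots_neq_0 [simp]: "monic_of_roots xs \<noteq> 0"
  by (induction xs) (auto simp del: mult_pCons_left)

lemma degree_monic_of_roots [simp]: "degree (monic_of_roots xs) = length xs"
  by (induction xs) (auto simp: degree_mult_eq simp del: mult_pCons_left)

lemma lead_coeff_monic_of_roots [simp]: "coeff (monic_of_roots xs) (length xs) = 1"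
proof -
  have "lead_coeff (monic_of_roots xs) = 1"
    by (induction xs) (auto simp: lead_coeff_mult simp del: mult_pCons_left)
  then show ?thesis by simp
qed

lemma poly_monic_of_roots_eq_0_iff [simp]: "poly (monic_of_roots xs) z = 0 \<longleftrightarrow> z \<in> set xs"
  by (induction xs) (auto simp: algebra_simps)

lemma monic_of_roots_mset_cong: "mset xs = mset ys \<Longrightarrow> monic_of_roots xs = monic_of_roots ys"
  unfolding monic_of_roots_def by (metis mset_map prod_mset_prod_list)

lemma reflect_monic_of_roots:
  "reflect_poly (monic_of_roots xs) = (\<Prod>x\<leftarrow>xs. [:1, - x:])"
proof -
  have "reflect_poly [:- x, 1:] = [:1, - x:]" for x :: complex
    by (rule poly_eqI) (auto simp: coeff_reflect_poly coeff_pCons split: nat.splits)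
  then show ?thesis
    by (simp add: monic_of_roots_def reflect_poly_prod_list o_def)
qed

text \<open>Newton's identities as a logarithmic derivative: the reversed polynomial is R = prod (1
  - x T), and R'/R = - sum x / (1 - x T) is minus the generating series of the power sums.\<close>

lemma fps_deriv_reflect_monic_of_roots:
  fixes xs :: "complex list"
  defines "R \<equiv> fps_of_poly (reflect_poly (monic_of_roots xs))"
  shows "fps_deriv R = - R * Abs_fps (\<lambda>k. \<Sum>x\<leftarrow>xs. x ^ Suc k)"
  unfolding R_def reflect_monic_of_roots
proof (induction xs)
  case (Cons x xs)
  let ?P = "\<lambda>xs::complex list. Abs_fps (\<lambda>k. \<Sum>x\<leftarrow>xs. x ^ Suc k)"
  let ?G = "Abs_fps (\<lambda>k. x ^ Suc k)"
  let ?R = "fps_of_poly (\<Prod>x\<leftarrow>xs. [:1, - x:])"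
  let ?l = "1 - fps_const x * fps_X"
  have lin: "fps_of_poly [:1, - x:] = ?l"
    by (simp add: fps_of_poly_pCons fps_const_neg[symmetric] mult.commute del: fps_const_neg)
  have geo: "?l * ?G = fps_const x"
  proof (rule fps_ext)
    fix n
    have "?l * ?G = ?G - fps_const x * (fps_X * ?G)" by (simp add: algebra_simps)
    then show "(?l * ?G) $ n = fps_const x $ n" by (cases n) simp_all
  qed
  have psum: "?P (x # xs) = ?G + ?P xs" by (rule fps_ext) simp
  have ring: "- (l * g) * r + l * (- r * p) = - (l * r) * (g + p)" for l r g p :: "complex fps"
    by (simp add: algebra_simps)
  have "fps_deriv (?l * ?R) = - fps_const x * ?R + ?l * (- ?R * ?P xs)"
    using Cons.IH by (simp add: fps_deriv_mult)
  also have "\<dots> = - (?l * ?R) * (?G + ?P xs)"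
    by (rule ring[of ?l ?G ?R "?P xs", unfolded geo])
  finally show ?case unfolding psum by (simp only: list.map prod_list.Cons fps_of_poly_mult lin)
qed (auto simp: fps_eq_iff)

text \<open>Newton's identities can be solved in both directions: for the next power sum because the
  reversed polynomial has constant term 1, and for the next coefficient because one may divide by k
  + 1. Rationality after an operation on the roots thus reduces to its effect on power sums.\<close>

lemma monic_of_roots_rat_iff:
  "(\<forall>k. coeff (monic_of_roots xs) k \<in> \<rat>) \<longleftrightarrow> (\<forall>k>0. (\<Sum>x\<leftarrow>xs. x ^ k) \<in> \<rat>)"
proof -
  define r where "r k = coeff (reflect_poly (monic_of_roots xs)) k" for k
  define p where "p k = (\<Sum>x\<leftarrow>xs. x ^ Suc k)" for k
  have r0: "r 0 = 1" by (simp add: r_def)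
  have newton: "of_nat (Suc k) * r (Suc k) = - (\<Sum>i=0..k. r i * p (k - i))" for k
    using arg_cong[OF fps_deriv_reflect_monic_of_roots[of xs], of "\<lambda>F. fps_nth F k"]
    by (simp only: fps_deriv_nth fps_mult_nth r_def p_def sum_negf fps_neg_nth fps_of_poly_nth mult_minus_left Suc_eq_plus1 fps_nth_Abs_fps)
  have "(\<forall>k. coeff (monic_of_roots xs) k \<in> \<rat>) \<longleftrightarrow> (\<forall>k. r k \<in> \<rat>)"
  proof (intro iffI allI)
    fix k assume *: "\<forall>k. coeff (monic_of_roots xs) k \<in> \<rat>"
    then show "r k \<in> \<rat>" by (simp add: r_def coeff_reflect_poly)
  next
    fix k assume *: "\<forall>k. r k \<in> \<rat>"
    show "coeff (monic_of_roots xs) k \<in> \<rat>"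
    proof (cases "k \<le> length xs")
      case True
      then have "r (length xs - k) = coeff (monic_of_roots xs) k"
        by (simp add: r_def coeff_reflect_poly)
      then show ?thesis using * by metis
    qed (simp add: coeff_eq_0)
  qed
  also have "\<dots> \<longleftrightarrow> (\<forall>k. p k \<in> \<rat>)"
  proof (intro iffI allI)
    fix k assume r: "\<forall>k. r k \<in> \<rat>"
    show "p k \<in> \<rat>"
    proof (induction k rule: less_induct)
      case (less k)
      have "p k = - (of_nat (Suc k) * r (Suc k)) - (\<Sum>i=1..k. r i * p (k - i))"
        unfolding newton by (simp add: sum.atLeast_Suc_atMost r0)
      also have "\<dots> \<in> \<rat>"
        using r less by (intro Rats_diff Rats_minus_iff[THEN iffD2] Rats_mult Rats_sum Rats_of_nat) auto
      finally show ?case .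
    qed
  next
    fix k assume p: "\<forall>k. p k \<in> \<rat>"
    show "r k \<in> \<rat>"
    proof (induction k rule: less_induct)
      case (less k)
      show ?case
      proof (cases k)
        case (Suc j)
        have "r k = - (\<Sum>i=0..j. r i * p (j - i)) / of_nat (Suc j)"
          using newton[of j] Suc by (simp add: field_simps del: of_nat_Suc)
        also have "\<dots> \<in> \<rat>"
          using p less Suc
          by (intro Rats_divide Rats_minus_iff[THEN iffD2] Rats_mult Rats_sum Rats_of_nat) auto
        finally show ?thesis .
      qed (simp add: r0)
    qed
  qed
  also have "\<dots> \<longleftrightarrow> (\<forall>k>0. (\<Sum>x\<leftarrow>xs. x ^ k) \<in> \<rat>)"
    unfolding p_def by (metis gr0_conv_Suc zero_less_Suc)
  finally show ?thesis .
qed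

lemma monic_of_roots_power_rat:
  assumes "\<And>k. coeff (monic_of_roots xs) k \<in> \<rat>" "L > 0"
  shows "coeff (monic_of_roots (map (\<lambda>x. x ^ L) xs)) k \<in> \<rat>"
proof -
  have "\<forall>k>0. (\<Sum>x\<leftarrow>map (\<lambda>x. x ^ L) xs. x ^ k) \<in> \<rat>"
    using assms monic_of_roots_rat_iff[of xs] by (simp add: o_def flip: power_mult)
  then show ?thesis using monic_of_roots_rat_iff by blast
qed

lemma monic_of_roots_inverse_rat:
  assumes "\<And>k. coeff (monic_of_roots xs) k \<in> \<rat>"
  shows "coeff (monic_of_roots (map inverse xs)) k \<in> \<rat>"
proof -
  \<comment> \<open>Since \<open>inverse 0 = 0\<close>, zero roots contribute nothing to positive
    power sums before or after inversion. Without them, inverting the roots amounts to reversing the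
    polynomial.\<close>
  define ys where "ys = filter (\<lambda>x. x \<noteq> 0) xs"
  have sums: "(\<Sum>x\<leftarrow>ys. f x) = (\<Sum>x\<leftarrow>xs. f x)" if "f 0 = 0" for f :: "complex \<Rightarrow> complex"
    unfolding ys_def using that by (induction xs) auto
  have "\<forall>k. coeff (monic_of_roots ys) k \<in> \<rat>"
    using assms unfolding monic_of_roots_rat_iff[of ys]
    by (simp add: sums monic_of_roots_rat_iff[of xs, symmetric])
  moreover define c where "c = coeff (monic_of_roots ys) 0"
  have "0 \<notin> set ys" by (simp add: ys_def)
  then have "reflect_poly (monic_of_roots ys) = smult c (monic_of_roots (map inverse ys))"
    unfolding reflect_monic_of_roots c_def
  proof (induction ys)
    case (Cons y ys)
    have "[:1, - y:] = smult (- y) [:- inverse y, 1:]" using Cons.prems by simp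
    then have "(\<Prod>x\<leftarrow>y # ys. [:1, - x:]) = smult (coeff (monic_of_roots ys) 0 * - y)
        ([:- inverse y, 1:] * monic_of_roots (map inverse ys))"
      using Cons.prems
      by (simp only: list.map prod_list.Cons Cons.IH list.set insert_iff de_Morgan_disj simp_thms
          mult_smult_left mult_smult_right smult_smult)
    then show ?case by (simp add: coeff_mult_0 mult.commute)
  qed simp
  then have "coeff (monic_of_roots (map inverse ys)) k
      = coeff (reflect_poly (monic_of_roots ys)) k / c" for k
    using \<open>0 \<notin> set ys\<close> poly_monic_of_roots_eq_0_iff[of ys 0] by (simp add: c_def poly_0_coeff_0)
  ultimately have "\<forall>k. coeff (monic_of_roots (map inverse ys)) k \<in> \<rat>"
    by (auto simp: c_def coeff_reflect_poly intro!: Rats_divide)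
  then have "\<forall>k. coeff (monic_of_roots (map inverse xs)) k \<in> \<rat>"
    unfolding monic_of_roots_rat_iff by (simp add: o_def sums)
  then show ?thesis by blast
qed

text \<open>The k-th power sum of all products x * y is the product of the two k-th power
  sums.\<close>

lemma monic_of_roots_products_rat:
  assumes "\<And>k. coeff (monic_of_roots xs) k \<in> \<rat>" "\<And>k. coeff (monic_of_roots ys) k \<in> \<rat>"
  shows "coeff (monic_of_roots (concat (map (\<lambda>x. map ((*) x) ys) xs))) k \<in> \<rat>"
proof -
  have "(\<Sum>z\<leftarrow>concat (map (\<lambda>x. map ((*) x) ys) xs). z ^ k) = (\<Sum>x\<leftarrow>xs. x ^ k) * (\<Sum>y\<leftarrow>ys. y ^ k)" for k
    by (induction xs) (simp_all add: o_def power_mult_distrib sum_list_const_mult algebra_simps)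
  then have "\<forall>k>0. (\<Sum>z\<leftarrow>concat (map (\<lambda>x. map ((*) x) ys) xs). z ^ k) \<in> \<rat>"
    using assms monic_of_roots_rat_iff[of xs] monic_of_roots_rat_iff[of ys] by simp
  then show ?thesis using monic_of_roots_rat_iff by blast
qed

lemma cpoly_factorization:
  obtains xs where "cpoly f = smult (of_int (lead_coeff f)) (monic_of_roots xs)"
proof -
  obtain A where A: "size A = degree (cpoly f)"
    "cpoly f = smult (lead_coeff (cpoly f)) (\<Prod>x\<in>#A. [:- x, 1:])"
    using complex_poly_decompose_multiset[of "cpoly f"] size_proots_complex by metis
  obtain xs where "A = mset xs" by (metis ex_mset)
  then show thesis
    using that[of xs] A(2) by (simp add: monic_of_roots_def flip: prod_mset_prod_list)
qed

section \<open>Orders of quotients of roots\<close>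

lemma card_int_polys_le:
  fixes d B :: nat
  defines "A \<equiv> {p::int poly. degree p \<le> d \<and> (\<forall>k. \<bar>coeff p k\<bar> \<le> int B)}"
  shows "finite A" "card A \<le> (2 * B + 1) ^ (d + 1)"
proof -
  let ?T = "{xs. set xs \<subseteq> {- int B..int B} \<and> length xs = d + 1}"
  let ?g = "\<lambda>p::int poly. map (coeff p) [0..<d + 1]"
  have inj: "inj_on ?g A"
  proof (rule inj_onI)
    fix p q assume pq: "p \<in> A" "q \<in> A" "?g p = ?g q"
    show "p = q"
    proof (rule poly_eqI)
      fix k show "coeff p k = coeff q k"
        using pq by (cases "k \<le> d") (auto simp: A_def coeff_eq_0 map_eq_conv simp del: upt_Suc)
    qed
  qed
  have sub: "?g ` A \<subseteq> ?T"
    by (force simp: A_def abs_le_iff simp del: upt_Suc)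
  have fin: "finite ?T" by (simp add: finite_lists_length_eq)
  show "finite A" using inj sub fin by (rule inj_on_finite)
  have "card A \<le> card ?T" using inj sub fin by (rule card_inj_on_le)
  also have "card ?T = (2 * B + 1) ^ (d + 1)"
  proof -
    have "card {- int B..int B} = 2 * B + 1" by simp
    then show ?thesis by (simp only: card_lists_length_eq[OF finite_atLeastAtMost_int])
  qed
  finally show "card A \<le> (2 * B + 1) ^ (d + 1)" .
qed

lemma norm_coeff_monic_of_roots_le:
  assumes "\<And>x. x \<in> set xs \<Longrightarrow> norm x \<le> 1"
  shows "norm (coeff (monic_of_roots xs) k) \<le> 2 ^ length xs"
  using assms
proof (induction xs arbitrary: k)
  case (Cons x xs)
  have IH: "norm (coeff (monic_of_roots xs) j) \<le> 2 ^ length xs" for j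
    using Cons by simp
  have "coeff (monic_of_roots (x # xs)) k
      = (case k of 0 \<Rightarrow> 0 | Suc j \<Rightarrow> coeff (monic_of_roots xs) j) - x * coeff (monic_of_roots xs) k"
    by (simp add: coeff_pCons split: nat.split)
  also have "norm \<dots> \<le> norm (case k of 0 \<Rightarrow> 0 | Suc j \<Rightarrow> coeff (monic_of_roots xs) j)
      + norm x * norm (coeff (monic_of_roots xs) k)"
    by (metis norm_mult norm_triangle_ineq4)
  also have "\<dots> \<le> 2 ^ length xs + 1 * 2 ^ length xs"
    using IH Cons.prems by (intro add_mono mult_mono) (auto split: nat.split)
  finally show ?case by simp
qed auto

lemma length_cpoly_factorization:
  assumes "cpoly f = smult (of_int (lead_coeff f)) (monic_of_roots xs)" "f \<noteq> 0"
  shows "length xs = degree f"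
proof -
  have "degree (smult (of_int (lead_coeff f)) (monic_of_roots xs)) = length xs"
    using assms(2) by simp
  then show ?thesis using assms(1) by (metis degree_cpoly)
qed

text \<open>The minimal integer polynomial of a root of unity divides some X^k - 1, so its leading
  coefficient is 1 or -1 and all its roots lie on the unit circle. Its coefficients are then at most
  2^d in absolute value, which leaves finitely many polynomials whatever k is.\<close>

lemma finite_roots_of_unity_bounded_degree:
  "finite {w. root_of_unity w \<and> (\<exists>q. q \<noteq> 0 \<and> degree q \<le> d \<and> (\<forall>i. coeff q i \<in> \<rat>) \<and> poly q w = 0)}"
    (is "finite ?W")
proof -
  define A where "A = {p::int poly. degree p \<le> d \<and> (\<forall>k. \<bar>coeff p k\<bar> \<le> int (2 ^ d))}"
  have "finite (\<Union>p\<in>A - {0}. {w. poly (cpoly p) w = 0})"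
    using card_int_polys_le(1)[of d "2 ^ d"] by (auto simp: A_def intro: poly_roots_finite)
  moreover have "?W \<subseteq> (\<Union>p\<in>A - {0}. {w. poly (cpoly p) w = 0})"
  proof safe
    fix w q
    assume w: "root_of_unity w" and q: "q \<noteq> 0" "degree q \<le> d" "\<forall>i. coeff q i \<in> \<rat>" "poly q w = 0"
    from w obtain k where k: "k > 0" "w ^ k = 1" by (auto simp: root_of_unity_def)
    have "algebraic w" using q unfolding algebraic_altdef by blast
    then obtain p where p: "p \<noteq> 0" "poly (cpoly p) w = 0"
        "\<And>g. poly (cpoly g) w = 0 \<Longrightarrow> p dvd g"
        "\<And>g. (\<And>i. coeff g i \<in> \<rat>) \<Longrightarrow> poly g w = 0 \<Longrightarrow> cpoly p dvd g"
      by (elim int_minimal_poly) blast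
    have "cpoly p dvd q" using p(4) q by blast
    then have deg: "degree p \<le> d" using q dvd_imp_degree_le[of "cpoly p" q] by simp
    define u :: "int poly" where "u = monom 1 k - 1"
    have cu: "cpoly u = monom 1 k - 1"
      unfolding u_def by (rule poly_eqI) (simp add: coeff_map_poly)
    have "p dvd u" using k by (intro p(3)) (simp add: cu poly_monom)
    then obtain h where h: "u = p * h" by (elim dvdE)
    have "lead_coeff u = 1"
    proof -
      have "coeff u k = 1" using k by (simp add: u_def)
      moreover from this have "degree u = k"
        by (intro antisym degree_le le_degree) (auto simp: u_def)
      ultimately show ?thesis by simp
    qed
    then have "lead_coeff p * lead_coeff h = 1" by (simp add: h lead_coeff_mult)
    then have lc: "\<bar>lead_coeff p\<bar> = 1" by (auto simp: zmult_eq_1_iff)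
    obtain xs where xs: "cpoly p = smult (of_int (lead_coeff p)) (monic_of_roots xs)"
      by (rule cpoly_factorization)
    have "length xs = degree p" using length_cpoly_factorization[OF xs] p(1) by simp
    moreover have "norm x \<le> 1" if "x \<in> set xs" for x
    proof -
      have "poly (cpoly p) x = 0" using that by (simp add: xs)
      then have "poly (cpoly u) x = 0" by (simp add: h cpoly_mult)
      then have "x ^ k = 1" by (simp add: cu poly_monom)
      then show ?thesis using k norm_power[of x k] power_eq_1_iff[of "norm x" k] by simp
    qed
    ultimately have "norm (coeff (monic_of_roots xs) j) \<le> 2 ^ degree p" for j
      using norm_coeff_monic_of_roots_le[of xs j] by simp
    moreover have "norm (coeff (cpoly p) j) = norm (coeff (monic_of_roots xs) j)" for j
      unfolding xs using lc by (simp add: norm_mult flip: of_int_abs)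
    ultimately have "real_of_int \<bar>coeff p j\<bar> \<le> 2 ^ degree p" for j
      by (simp add: norm_of_int)
    also have "(2::real) ^ degree p \<le> 2 ^ d" using deg by simp
    finally have "\<bar>coeff p j\<bar> \<le> int (2 ^ d)" for j
      by (metis (mono_tags, lifting) of_int_le_iff of_int_of_nat_eq of_nat_numeral of_nat_power)
    then have "p \<in> A - {0}" using deg p(1) by (simp add: A_def)
    then show "w \<in> (\<Union>p\<in>A - {0}. {w. poly (cpoly p) w = 0})" using p(2) by blast
  qed
  ultimately show ?thesis by (rule rev_finite_subset)
qed

lemma monic_of_roots_rat:
  assumes "cpoly f = smult (of_int (lead_coeff f)) (monic_of_roots xs)" "f \<noteq> 0"
  shows "coeff (monic_of_roots xs) k \<in> \<rat>"
proof -
  have "of_int (coeff f k) = of_int (lead_coeff f) * coeff (monic_of_roots xs) k"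
    using arg_cong[OF assms(1), of "\<lambda>p. coeff p k"] by simp
  then have "coeff (monic_of_roots xs) k = of_int (coeff f k) / of_int (lead_coeff f)"
    using assms(2) by (simp add: field_simps)
  then show ?thesis by simp
qed

text \<open>A quotient of two roots of a polynomial of degree \<open>n\<close> is a root of the rational polynomial
  whose roots are all such quotients, so it has degree at most \<open>n\<^sup>2\<close>; only finitely
  many roots of unity have that degree.\<close>
lemma uniform_exponent:
  obtains L where "L > 0" "\<And>f x y. f \<noteq> 0 \<Longrightarrow> degree f = n \<Longrightarrow> poly (cpoly f) x = 0 \<Longrightarrow>
    poly (cpoly f) y = 0 \<Longrightarrow> root_of_unity (x / y) \<Longrightarrow> (x / y) ^ L = 1"
proof -
  define W where "W = {w. root_of_unity w \<and>
      (\<exists>q. q \<noteq> 0 \<and> degree q \<le> n * n \<and> (\<forall>i. coeff q i \<in> \<rat>) \<and> poly q w = 0)}"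
  have "finite W" unfolding W_def by (rule finite_roots_of_unity_bounded_degree)
  have "\<exists>k. \<forall>w\<in>W. k w > 0 \<and> w ^ k w = 1"
    by (rule bchoice) (auto simp: W_def root_of_unity_def)
  then obtain k where k: "\<And>w. w \<in> W \<Longrightarrow> k w > 0 \<and> w ^ k w = 1" by blast
  define L where "L = (\<Prod>w\<in>W. k w)"
  show thesis
  proof (rule that)
    show "L > 0" unfolding L_def using k by (intro prod_pos) blast
    fix f x y
    assume f: "f \<noteq> 0" "degree f = n" "poly (cpoly f) x = 0" "poly (cpoly f) y = 0"
      and xy: "root_of_unity (x / y)"
    obtain xs where xs: "cpoly f = smult (of_int (lead_coeff f)) (monic_of_roots xs)"
      by (rule cpoly_factorization)
    define zs where "zs = concat (map (\<lambda>x. map ((*) x) (map inverse xs)) xs)"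
    have "coeff (monic_of_roots zs) i \<in> \<rat>" for i
      unfolding zs_def
      by (intro monic_of_roots_products_rat monic_of_roots_inverse_rat monic_of_roots_rat[OF xs f(1)])
    moreover have "length xs = n" using length_cpoly_factorization[OF xs] f by simp
    then have "length zs = n * n"
      by (simp add: zs_def length_concat o_def map_replicate_const sum_list_replicate)
    moreover have "x \<in> set xs" "y \<in> set xs" using f xs by auto
    then have "x / y \<in> set zs" by (auto simp: zs_def field_simps)
    ultimately have "x / y \<in> W"
      unfolding W_def using xy by (auto intro!: exI[of _ "monic_of_roots zs"])
    then have "k (x / y) dvd L" unfolding L_def using \<open>finite W\<close> by (rule dvd_prodI[rotated])
    then show "(x / y) ^ L = 1" using k[OF \<open>x / y \<in> W\<close>] by (metis dvdE power_mult power_one)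
  qed
qed

section \<open>Integer points in the image of a polynomial map\<close>

interpretation fun_space: vector_space "\<lambda>(c::complex) (f::(nat \<Rightarrow> complex) \<Rightarrow> complex) x. c * f x"
  by unfold_locales (auto simp: fun_eq_iff algebra_simps)

text \<open>Monomials are taken as functions, because the polynomial method only evaluates them. The
  degree is bounded in each variable separately: there are then at most (N + 1)^d monomials, and the
  bounds add up under multiplication.\<close>

definition monomial_funs :: "nat \<Rightarrow> nat \<Rightarrow> ((nat \<Rightarrow> complex) \<Rightarrow> complex) set" where
  "monomial_funs d N = {(\<lambda>p. \<Prod>j<d. p j ^ \<alpha> j) | \<alpha>. \<forall>j<d. \<alpha> j \<le> N}"

definition poly_funs :: "nat \<Rightarrow> nat \<Rightarrow> ((nat \<Rightarrow> complex) \<Rightarrow> complex) set" where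
  "poly_funs d N = fun_space.span (monomial_funs d N)"

lemma card_monomial_funs_le:
  shows "finite (monomial_funs d N)" "card (monomial_funs d N) \<le> (N + 1) ^ d"
proof -
  let ?A = "{..<d} \<rightarrow>\<^sub>E {..N}"
  let ?m = "\<lambda>\<alpha> p. \<Prod>j<d. p j ^ \<alpha> j :: complex"
  have sub: "monomial_funs d N \<subseteq> ?m ` ?A"
  proof
    fix f assume "f \<in> monomial_funs d N"
    then obtain \<alpha> where "f = ?m \<alpha>" "\<forall>j<d. \<alpha> j \<le> N" by (auto simp: monomial_funs_def)
    then show "f \<in> ?m ` ?A"
      by (intro image_eqI[of _ _ "restrict \<alpha> {..<d}"]) (auto simp: fun_eq_iff)
  qed
  have fin: "finite ?A" by (intro finite_PiE) auto
  show "finite (monomial_funs d N)" using sub fin by (meson finite_imageI finite_subset)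
  have "card (monomial_funs d N) \<le> card (?m ` ?A)" using sub fin by (intro card_mono) auto
  also have "\<dots> \<le> card ?A" using fin by (rule card_image_le)
  also have "\<dots> = (N + 1) ^ d" by (simp add: card_PiE)
  finally show "card (monomial_funs d N) \<le> (N + 1) ^ d" .
qed

lemma poly_funs_mono: "N \<le> M \<Longrightarrow> poly_funs d N \<subseteq> poly_funs d M"
  unfolding poly_funs_def
  by (intro fun_space.span_mono) (auto simp: monomial_funs_def intro: order_trans)

lemma poly_funs_add: "f \<in> poly_funs d N \<Longrightarrow> g \<in> poly_funs d N \<Longrightarrow> (\<lambda>p. f p + g p) \<in> poly_funs d N"
  unfolding poly_funs_def using fun_space.span_add[of f _ g] by (simp add: plus_fun_def)

lemma poly_funs_scale: "f \<in> poly_funs d N \<Longrightarrow> (\<lambda>p. c * f p) \<in> poly_funs d N"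
  unfolding poly_funs_def by (rule fun_space.span_scale)

lemma poly_funs_const: "(\<lambda>p. c) \<in> poly_funs d N"
proof -
  have "(\<lambda>p. 1) \<in> monomial_funs d N"
    unfolding monomial_funs_def by (auto intro!: exI[of _ "\<lambda>_. 0"])
  then have "(\<lambda>p. 1) \<in> poly_funs d N" unfolding poly_funs_def by (rule fun_space.span_base)
  from poly_funs_scale[OF this, of c] show ?thesis by simp
qed

lemma poly_funs_diff_const: "f \<in> poly_funs d N \<Longrightarrow> (\<lambda>p. f p - c) \<in> poly_funs d N"
  using poly_funs_add[OF _ poly_funs_const[of "- c"]] by simp

lemma poly_funs_var: "j < d \<Longrightarrow> (\<lambda>p. p j) \<in> poly_funs d 1"
  unfolding poly_funs_def
proof (rule fun_space.span_base)
  assume "j < d"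
  then have "(\<Prod>i<d. p i ^ (if i = j then 1 else 0)) = p j" for p :: "nat \<Rightarrow> complex"
    by (subst prod.remove[of _ j]) auto
  then show "(\<lambda>p. p j) \<in> monomial_funs d 1"
    unfolding monomial_funs_def by (auto intro!: exI[of _ "\<lambda>i. if i = j then 1 else 0"])
qed

lemma poly_funs_mult:
  assumes "f \<in> poly_funs d N" "g \<in> poly_funs d M"
  shows "(\<lambda>p. f p * g p) \<in> poly_funs d (N + M)"
  using assms(1) unfolding poly_funs_def[of d N]
proof (induction rule: fun_space.span_induct_alt)
  case base
  show ?case using poly_funs_const[of 0] by (simp add: zero_fun_def)
next
  case (step c m h)
  from step(1) obtain \<alpha> where \<alpha>: "m = (\<lambda>p. \<Prod>j<d. p j ^ \<alpha> j)" "\<forall>j<d. \<alpha> j \<le> N"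
    by (auto simp: monomial_funs_def)
  have "(\<lambda>p. m p * g p) \<in> poly_funs d (N + M)"
    using assms(2) unfolding poly_funs_def[of d M]
  proof (induction rule: fun_space.span_induct_alt)
    case base
    show ?case using poly_funs_const[of 0] by (simp add: zero_fun_def)
  next
    case (step c m' h)
    from step(1) obtain \<beta> where \<beta>: "m' = (\<lambda>p. \<Prod>j<d. p j ^ \<beta> j)" "\<forall>j<d. \<beta> j \<le> M"
      by (auto simp: monomial_funs_def)
    have "(\<lambda>p. m p * m' p) = (\<lambda>p. \<Prod>j<d. p j ^ (\<alpha> j + \<beta> j))"
      by (simp add: \<alpha>(1) \<beta>(1) power_add prod.distrib)
    moreover have "\<dots> \<in> monomial_funs d (N + M)"
      unfolding monomial_funs_def using \<alpha>(2) \<beta>(2)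
      by (auto intro!: exI[of _ "\<lambda>j. \<alpha> j + \<beta> j"] add_mono)
    ultimately have "(\<lambda>p. m p * m' p) \<in> poly_funs d (N + M)"
      unfolding poly_funs_def by (simp add: fun_space.span_base)
    from poly_funs_add[OF poly_funs_scale[OF this, of c] step(2)] show ?case
      by (simp add: algebra_simps)
  qed
  from poly_funs_add[OF poly_funs_scale[OF this, of c] step(2)] show ?case
    by (simp add: algebra_simps)
qed

lemma poly_funs_prod:
  assumes "finite A" "\<And>a. a \<in> A \<Longrightarrow> f a \<in> poly_funs d N"
  shows "(\<lambda>p. \<Prod>a\<in>A. f a p) \<in> poly_funs d (N * card A)"
  using assms
proof (induction A)
  case empty
  show ?case using poly_funs_const[of 1] by simp
next
  case (insert a A)
  then show ?case using poly_funs_mult[of "f a" d N "\<lambda>p. \<Prod>a\<in>A. f a p" "N * card A"]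
    by (simp add: algebra_simps)
qed

text \<open>The polynomial method: the indicator functions of the points of \<open>E\<close>, written as products of
  coordinate differences and pulled back along \<open>\<Phi>\<close>, are linearly independent polynomials in
  the parameters, and their number cannot exceed the number of monomials.\<close>
lemma card_grid_points_in_image_le:
  fixes E :: "int poly set" and \<Phi> :: "nat \<Rightarrow> (nat \<Rightarrow> complex) \<Rightarrow> complex"
  assumes E: "\<And>f. f \<in> E \<Longrightarrow> degree f \<le> n" "\<And>f k. f \<in> E \<Longrightarrow> \<bar>coeff f k\<bar> \<le> int H"
    and \<Phi>: "\<And>k. k \<le> n \<Longrightarrow> \<Phi> k \<in> poly_funs d D"
    and param: "\<And>f. f \<in> E \<Longrightarrow> \<exists>p. \<forall>k\<le>n. of_int (coeff f k) = \<Phi> k p"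
  shows "card E \<le> (D * (2 * H) * (n + 1) + 1) ^ d"
proof -
  have "finite E"
    using card_int_polys_le(1)[of n H] by (rule finite_subset[rotated]) (use E in auto)
  obtain p where p: "\<And>f k. f \<in> E \<Longrightarrow> k \<le> n \<Longrightarrow> \<Phi> k (p f) = of_int (coeff f k)"
    using param by metis
  define S where "S e k = {- int H..int H} - {coeff e k}" for e k
  define \<delta> where "\<delta> e x = (\<Prod>k\<le>n. \<Prod>s\<in>S e k. \<Phi> k x - of_int s)" for e x
  have diag: "\<delta> e (p e) \<noteq> 0" if "e \<in> E" for e
  proof -
    have "\<Phi> k (p e) - of_int s \<noteq> 0" if "k \<le> n" "s \<in> S e k" for k s
      using that p[OF \<open>e \<in> E\<close> that(1)] by (auto simp: S_def)
    then show ?thesis unfolding \<delta>_def by (subst prod_zero_iff; force simp: S_def)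
  qed
  have off_diag: "\<delta> e (p e') = 0" if e: "e \<in> E" "e' \<in> E" "e \<noteq> e'" for e e'
  proof -
    obtain k where k: "k \<le> n" "coeff e' k \<noteq> coeff e k"
      using e E(1) by (metis coeff_eq_0 le_less_trans linorder_not_le poly_eqI)
    moreover have "\<bar>coeff e' k\<bar> \<le> int H" using E(2) e by blast
    ultimately have "coeff e' k \<in> S e k" by (auto simp: S_def)
    then have "\<exists>s\<in>S e k. \<Phi> k (p e') - of_int s = 0" using p[OF e(2) k(1)] by force
    then have "(\<Prod>s\<in>S e k. \<Phi> k (p e') - of_int s) = 0"
      by (subst prod_zero_iff) (auto simp: S_def)
    then show ?thesis using k(1) by (auto simp: \<delta>_def)
  qed
  \<comment> \<open>In each of the n + 1 coordinates the product omits one of the 2H + 1 grid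
    values, leaving 2H factors. The degree in every parameter is thus linear in H, which is why d
    parameters give O(H^d) points.\<close>
  have \<delta>_in: "\<delta> e \<in> poly_funs d (D * (2 * H) * (n + 1))" if e: "e \<in> E" for e
  proof -
    have "(\<lambda>x. \<Prod>s\<in>S e k. \<Phi> k x - of_int s) \<in> poly_funs d (D * (2 * H))" if "k \<in> {..n}" for k
    proof -
      have "\<bar>coeff e k\<bar> \<le> int H" using E(2) e by blast
      then have "card (S e k) = 2 * H" by (simp add: S_def card_Diff_singleton abs_le_iff)
      then show ?thesis
        using poly_funs_prod[of "S e k" "\<lambda>s x. \<Phi> k x - of_int s" d D] that \<Phi>
        by (auto simp: S_def intro: poly_funs_diff_const)
    qed
    from poly_funs_prod[OF _ this, of "{..n}"] show ?thesis
      by (simp add: \<delta>_def[abs_def])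
  qed
  have sum_apply: "(\<Sum>a\<in>A. f a) x = (\<Sum>a\<in>A. f a x)"
    for A and f :: "'b \<Rightarrow> (nat \<Rightarrow> complex) \<Rightarrow> complex" and x
    by (induction A rule: infinite_finite_induct) auto
  have inj: "inj_on \<delta> E" using diag off_diag by (metis inj_onI)
  have scalars_zero: "u (\<delta> e) = 0"
    if sum0: "(\<Sum>h\<in>\<delta> ` E. (\<lambda>x. u h * h x)) = 0" and e: "e \<in> E" for u e
  proof -
    have "0 = (\<Sum>h\<in>\<delta> ` E. u h * h (p e))"
      using fun_cong[OF sum0, of "p e"] by (simp add: sum_apply)
    also have "\<dots> = (\<Sum>e'\<in>E. u (\<delta> e') * \<delta> e' (p e))" using inj by (simp add: sum.reindex)
    also have "\<dots> = (\<Sum>e'\<in>E. if e' = e then u (\<delta> e) * \<delta> e (p e) else 0)"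
      using off_diag e by (intro sum.cong) auto
    also have "\<dots> = u (\<delta> e) * \<delta> e (p e)" using \<open>finite E\<close> e by simp
    finally show ?thesis using diag e by simp
  qed
  have "fun_space.independent (\<delta> ` E)"
    apply (rule fun_space.independent_if_scalars_zero)
    subgoal using \<open>finite E\<close> by simp
    subgoal for u g using scalars_zero[of u] by blast
    done
  moreover have "\<delta> ` E \<subseteq> fun_space.span (monomial_funs d (D * (2 * H) * (n + 1)))"
    using \<delta>_in by (auto simp: poly_funs_def)
  ultimately have "card (\<delta> ` E) \<le> card (monomial_funs d (D * (2 * H) * (n + 1)))"
    using fun_space.independent_span_bound card_monomial_funs_le(1) by blast
  also have "card (\<delta> ` E) = card E" using inj by (rule card_image)
  finally show ?thesis using card_monomial_funs_le(2) by (rule order_trans)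
qed

section \<open>Polynomials whose roots have few distinct powers\<close>

text \<open>Coordinate 0 of the parameter vector is reserved for the leading coefficient, hence the
  shift to \<open>Suc c\<close>. Each linear factor raises the degrees by at most one.\<close>

lemma poly_funs_coeff_monic_of_roots:
  assumes "\<And>z c. (z, c) \<in> set ps \<Longrightarrow> c < d"
  shows "(\<lambda>p. coeff (monic_of_roots (map (\<lambda>(z, c). z * p (Suc c)) ps)) k) \<in> poly_funs (Suc d) (length ps)"
  using assms
proof (induction ps arbitrary: k)
  case Nil
  then show ?case using poly_funs_const by simp
next
  case (Cons zc ps)
  obtain z c where zc: "zc = (z, c)" by fastforce
  let ?q = "\<lambda>p. monic_of_roots (map (\<lambda>(z, c). z * p (Suc c)) ps)"
  have IH: "(\<lambda>p. coeff (?q p) j) \<in> poly_funs (Suc d) (length ps)" for j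
    using Cons by auto
  have "c < d" using Cons.prems zc by auto
  then have "(\<lambda>p. p (Suc c)) \<in> poly_funs (Suc d) 1" by (intro poly_funs_var) simp
  from poly_funs_mult[OF poly_funs_scale[OF this, of "- z"] IH[of k]]
  have 1: "(\<lambda>p. - z * p (Suc c) * coeff (?q p) k) \<in> poly_funs (Suc d) (length (zc # ps))" by simp
  have 2: "(\<lambda>p. case k of 0 \<Rightarrow> 0 | Suc j \<Rightarrow> coeff (?q p) j) \<in> poly_funs (Suc d) (length (zc # ps))"
    using IH poly_funs_mono[of "length ps" "length (zc # ps)"]
    by (cases k) (auto intro: poly_funs_const)
  from poly_funs_add[OF 1 2] show ?case
    by (simp add: zc coeff_pCons split: nat.split)
qed

lemma card_few_root_powers_le:
  fixes n d L :: nat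
  assumes "L > 0"
  obtains K where "\<And>H. H > 0 \<Longrightarrow>
    card {f. f \<noteq> 0 \<and> degree f = n \<and> (\<forall>k. \<bar>coeff f k\<bar> \<le> int H) \<and>
             card ((\<lambda>x. x ^ L) ` {x. poly (cpoly f) x = 0}) \<le> d} \<le> K * H ^ (d + 1)"
proof -
  define T where "T = {ps. set ps \<subseteq> {z::complex. z ^ L = 1} \<times> {..<d} \<and> length ps = n}"
  have "finite T" unfolding T_def
    using assms by (intro finite_lists_length_eq finite_cartesian_product finite_roots_unity) auto
  define \<Phi> where "\<Phi> ps k p = p 0 * coeff (monic_of_roots (map (\<lambda>(z, c). z * p (Suc c)) ps)) k"
    for ps :: "(complex \<times> nat) list" and k p
  define K where "K = card T * ((n + 1) * 2 * (n + 1) + 1) ^ (d + 1)"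
  show thesis
  proof (rule that[of K])
    fix H :: nat assume "H > 0"
    define A where "A = {f. f \<noteq> 0 \<and> degree f = n \<and> (\<forall>k. \<bar>coeff f k\<bar> \<le> int H) \<and>
        card ((\<lambda>x. x ^ L) ` {x. poly (cpoly f) x = 0}) \<le> d}"
    define E where "E ps = {f\<in>A. \<exists>p. \<forall>k\<le>n. of_int (coeff f k) = \<Phi> ps k p}" for ps
    have cover: "A \<subseteq> (\<Union>ps\<in>T. E ps)"
    proof
      fix f assume f: "f \<in> A"
      obtain xs where xs: "cpoly f = smult (of_int (lead_coeff f)) (monic_of_roots xs)"
        by (rule cpoly_factorization)
      have len: "length xs = n" using length_cpoly_factorization[OF xs] f by (simp add: A_def)
      define V where "V = (\<lambda>x. x ^ L) ` set xs"
      have "set xs = {x. poly (cpoly f) x = 0}"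
        using f by (auto simp: A_def xs)
      then have "card V \<le> d" using f by (simp add: A_def V_def)
      have "finite V" by (simp add: V_def)
      obtain e where e: "inj_on e V" "e ` V \<subseteq> {..<d}"
      proof -
        from ex_bij_betw_finite_nat[OF \<open>finite V\<close>] obtain h where "bij_betw h V {0..<card V}" by blast
        with \<open>card V \<le> d\<close> show thesis by (intro that[of h]) (auto simp: bij_betw_def)
      qed
      \<comment> \<open>One root is chosen as representative of each value of the L-th power; any
        other root with that value differs from it by an L-th root of unity.\<close>
      define s where "s v = inv_into (set xs) (\<lambda>x. x ^ L) v" for v
      have s: "s (x ^ L) ^ L = x ^ L" if "x \<in> set xs" for x
        unfolding s_def using that f_inv_into_f[of "x ^ L" "\<lambda>x. x ^ L" "set xs"] by auto
      \<comment> \<open>Coordinate 0 carries the leading coefficient, and coordinate j + 1 the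
        representative of the value numbered j. Numbers j that are not taken by any value get
        arbitrary entries, which the shape never refers to.\<close>
      define p where "p = case_nat (of_int (lead_coeff f)) (\<lambda>j. s (inv_into V e j))"
      \<comment> \<open>For x = 0 the representative is 0 and the quotient 0 / 0 = 0 would not be a
        root of unity, so 1 is used instead.\<close>
      define ps where "ps = map (\<lambda>x. (if x = 0 then 1 else x / s (x ^ L), e (x ^ L))) xs"
      have prod: "fst zc * p (Suc (snd zc)) = x" and unity: "fst zc ^ L = 1" and idx: "snd zc < d"
        if "zc = (if x = 0 then 1 else x / s (x ^ L), e (x ^ L))" "x \<in> set xs" for x zc
      proof -
        have v: "x ^ L \<in> V" using that by (auto simp: V_def)
        then have p: "p (Suc (snd zc)) = s (x ^ L)"
          using e(1) by (simp add: p_def that(1))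
        show "snd zc < d" using e(2) v that by auto
        show "fst zc * p (Suc (snd zc)) = x" "fst zc ^ L = 1"
          using s[OF that(2)] assms unfolding p by (auto simp: that(1) power_divide zero_power)
      qed
      have "map (\<lambda>(z, c). z * p (Suc c)) ps = map (\<lambda>x. x) xs"
        unfolding ps_def map_map using prod by (intro map_cong) (auto simp: case_prod_beta)
      then have "of_int (coeff f k) = \<Phi> ps k p" for k
        using arg_cong[OF xs, of "\<lambda>q. coeff q k"] by (simp add: \<Phi>_def p_def)
      then have "f \<in> E ps" using f by (auto simp: E_def)
      moreover have "zc \<in> {z. z ^ L = 1} \<times> {..<d}" if "zc \<in> set ps" for zc
      proof -
        from that obtain x where "x \<in> set xs" "zc = (if x = 0 then 1 else x / s (x ^ L), e (x ^ L))"
          unfolding ps_def by auto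
        from unity[OF this(2,1)] idx[OF this(2,1)] show ?thesis by (cases zc) auto
      qed
      then have "ps \<in> T" using len by (auto simp: T_def ps_def)
      ultimately show "f \<in> (\<Union>ps\<in>T. E ps)" by blast
    qed
    have card_E: "card (E ps) \<le> ((n + 1) * (2 * H) * (n + 1) + 1) ^ (d + 1)" if "ps \<in> T" for ps
    proof -
      have ps: "\<And>z c. (z, c) \<in> set ps \<Longrightarrow> c < d" "length ps = n"
        using that by (auto simp: T_def)
      have "\<Phi> ps k \<in> poly_funs (Suc d) (n + 1)" for k
        using poly_funs_mult[OF poly_funs_var[of 0 "Suc d"] poly_funs_coeff_monic_of_roots[of ps d k]] ps
        by (simp add: \<Phi>_def[abs_def])
      then have "card (E ps) \<le> ((n + 1) * (2 * H) * (n + 1) + 1) ^ Suc d"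
        by (intro card_grid_points_in_image_le[of _ n H "\<Phi> ps"]) (auto simp: E_def A_def)
      then show ?thesis by simp
    qed
    have "finite A"
      using card_int_polys_le(1)[of n H] by (rule finite_subset[rotated]) (auto simp: A_def)
    then have "finite (\<Union>ps\<in>T. E ps)" by (rule finite_subset[rotated]) (auto simp: E_def)
    then have "card A \<le> card (\<Union>ps\<in>T. E ps)" using cover by (rule card_mono)
    also have "\<dots> \<le> (\<Sum>ps\<in>T. card (E ps))" using \<open>finite T\<close> by (rule card_UN_le)
    also have "\<dots> \<le> (\<Sum>ps\<in>T. ((n + 1) * (2 * H) * (n + 1) + 1) ^ (d + 1))"
      using card_E by (rule sum_mono)
    also have "\<dots> \<le> (\<Sum>ps\<in>T. (((n + 1) * 2 * (n + 1) + 1) * H) ^ (d + 1))"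
      using \<open>H > 0\<close> by (intro sum_mono power_mono) (auto simp: algebra_simps)
    also have "\<dots> = K * H ^ (d + 1)"
      by (simp only: sum_constant power_mult_distrib K_def mult.assoc of_nat_id)
    finally show "card {f. f \<noteq> 0 \<and> degree f = n \<and> (\<forall>k. \<bar>coeff f k\<bar> \<le> int H) \<and>
        card ((\<lambda>x. x ^ L) ` {x. poly (cpoly f) x = 0}) \<le> d} \<le> K * H ^ (d + 1)"
      by (simp add: A_def)
  qed
qed

section \<open>Polynomials with exactly one degenerate pair\<close>

lemma pderiv_monic_of_roots_eq: "poly (pderiv (monic_of_roots (r # ys))) r = poly (monic_of_roots ys) r"
  by (simp add: pderiv_mult pderiv_pCons del: mult_pCons_left)

lemma poly_eq_prod_simple_roots:
  fixes q :: "complex poly"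
  assumes "\<And>r. poly q r = 0 \<Longrightarrow> poly (pderiv q) r \<noteq> 0" "{r. poly q r = 0} = S"
  shows "q = smult (lead_coeff q) (\<Prod>r\<in>S. [:- r, 1:])"
proof -
  have "rsquarefree q" using assms(1) by (auto simp: rsquarefree_roots)
  from complex_poly_decompose_rsquarefree[OF this] show ?thesis by (simp add: assms(2))
qed

text \<open>The minimal polynomial of t divides both the given polynomial and its derivative, so
  each of its roots is a multiple root. Only t is one, and it is a simple root of its minimal
  polynomial, which is therefore linear.\<close>

lemma monic_double_root_rat:
  assumes rat: "\<And>k. coeff (monic_of_roots (t # t # ys)) k \<in> \<rat>" and dist: "distinct (t # ys)"
  shows "t \<in> \<rat>"
proof -
  let ?B = "monic_of_roots (t # t # ys)"
  have "algebraic t"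
    unfolding algebraic_altdef by (rule exI[of _ ?B]) (use rat in \<open>simp del: monic_of_roots_simps\<close>)
  then obtain p where p: "p \<noteq> 0" "poly (cpoly p) t = 0" "poly (pderiv (cpoly p)) t \<noteq> 0"
      "\<And>g. (\<And>i. coeff g i \<in> \<rat>) \<Longrightarrow> poly g t = 0 \<Longrightarrow> cpoly p dvd g"
    by (elim int_minimal_poly) blast
  have "cpoly p dvd ?B"
    by (rule p(4)) (use rat in \<open>simp_all del: monic_of_roots_simps\<close>)
  have "cpoly p dvd pderiv ?B"
    by (rule p(4)) (use rat pderiv_monic_of_roots_eq[of t "t # ys"]
        in \<open>simp_all add: coeff_pderiv del: monic_of_roots_simps\<close>)
  have only_t: "r = t" if r: "poly (cpoly p) r = 0" for r
  proof (rule ccontr)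
    assume "r \<noteq> t"
    have B0: "poly ?B r = 0" "poly (pderiv ?B) r = 0"
      using r \<open>cpoly p dvd ?B\<close> \<open>cpoly p dvd pderiv ?B\<close> by (metis dvd_trans poly_eq_0_iff_dvd)+
    then have "r \<in> set ys" using \<open>r \<noteq> t\<close> by (simp del: monic_of_roots_simps)
    define zs where "zs = t # t # remove1 r ys"
    have "?B = monic_of_roots (r # zs)"
      using \<open>r \<in> set ys\<close> by (intro monic_of_roots_mset_cong) (simp add: zs_def)
    then have "poly (monic_of_roots zs) r = 0"
      using B0(2) by (simp only: pderiv_monic_of_roots_eq)
    moreover have "r \<notin> set zs" using dist \<open>r \<noteq> t\<close> by (auto simp: zs_def)
    ultimately show False by simp
  qed
  have "{r. poly (cpoly p) r = 0} = {t}" using only_t p(2) by blast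
  then have eq: "cpoly p = smult (lead_coeff (cpoly p)) (\<Prod>r\<in>{t}. [:- r, 1:])"
    using p(3) only_t by (intro poly_eq_prod_simple_roots) auto
  have "of_int (coeff p 0) = of_int (lead_coeff p) * (- t)"
    using arg_cong[OF eq, of "\<lambda>q. coeff q 0"] by simp
  then have "t = - of_int (coeff p 0) / of_int (lead_coeff p)"
    using p(1) by (simp add: field_simps)
  then show ?thesis by simp
qed

text \<open>Once t = a^L is rational, the minimal polynomials of a and b divide both f and X^L - t,
  so their roots lie in {a, b}. Either one of them already has both roots, or both are linear and
  their product is the factor.\<close>

lemma unique_pair_quadratic_factor:
  assumes f: "f \<noteq> 0" and L: "L > 0" and ab: "a \<noteq> b" "a ^ L = b ^ L"
    and roots: "poly (cpoly f) a = 0" "poly (cpoly f) b = 0"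
    and card: "degree f \<le> card ((\<lambda>x. x ^ L) ` {x. poly (cpoly f) x = 0}) + 1"
  obtains U v where "f = U * v" "cpoly U = smult (of_int (lead_coeff U)) ([:- a, 1:] * [:- b, 1:])"
proof -
  obtain xs where xs: "cpoly f = smult (of_int (lead_coeff f)) (monic_of_roots xs)"
    by (rule cpoly_factorization)
  have set_xs: "set xs = {x. poly (cpoly f) x = 0}" using f by (auto simp: xs)
  define ys where "ys = remove1 b (remove1 a xs)"
  have "a \<in> set xs" "b \<in> set (remove1 a xs)"
    using roots ab(1) by (auto simp: set_xs in_set_remove1)
  then have "mset xs = add_mset a (mset (remove1 a xs))"
    and "mset (remove1 a xs) = add_mset b (mset ys)"
    unfolding ys_def by (metis insert_DiffM mset_remove1 set_mset_mset)+
  then have mset_xs: "mset xs = mset (a # b # ys)" by simp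
  have xs_eq: "monic_of_roots xs = monic_of_roots (a # b # ys)"
    using mset_xs by (rule monic_of_roots_mset_cong)
  have set_ys: "set xs = insert a (insert b (set ys))"
    using mset_eq_setD[OF mset_xs] by simp
  have len: "length xs = length ys + 2"
    using mset_eq_length[OF mset_xs] by simp
  define t where "t = a ^ L"
  let ?P = "map (\<lambda>x. x ^ L)"
  have "(\<lambda>x. x ^ L) ` {x. poly (cpoly f) x = 0} = set (t # ?P ys)"
    unfolding set_xs[symmetric] set_ys using ab(2) by (auto simp: t_def)
  \<comment> \<open>Outside the pair there are n - 2 roots; with t they provide n - 1 powers, and
    the cardinality hypothesis requires at least n - 1 distinct values. Hence no further coincidence
    occurs.\<close>
  then have "length (t # ?P ys) \<le> card (set (t # ?P ys))"
    using card length_cpoly_factorization[OF xs f] len by simp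
  then have dist: "distinct (t # ?P ys)"
    by (metis antisym card_distinct card_length)
  have "t \<in> \<rat>"
  proof (rule monic_double_root_rat[OF _ dist])
    fix k
    have "\<And>k. coeff (monic_of_roots (a # b # ys)) k \<in> \<rat>"
      using monic_of_roots_rat[OF xs f] by (simp only: xs_eq)
    from monic_of_roots_power_rat[OF this L, of k]
    show "coeff (monic_of_roots (t # t # ?P ys)) k \<in> \<rat>"
      using ab(2) by (simp add: t_def del: monic_of_roots_simps)
  qed
  have min_poly: "\<exists>p. p dvd f \<and> poly (cpoly p) c = 0 \<and> (\<forall>g. poly (cpoly g) c = 0 \<longrightarrow> p dvd g)
      \<and> {r. poly (cpoly p) r = 0} \<subseteq> {a, b}
      \<and> (\<forall>S. {r. poly (cpoly p) r = 0} = S \<longrightarrow>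
          cpoly p = smult (of_int (lead_coeff p)) (\<Prod>r\<in>S. [:- r, 1:]))"
    if c: "c \<in> {a, b}" for c
  proof -
    have "poly (cpoly f) c = 0" using roots c by auto
    then have "algebraic c" unfolding algebraic_altdef
      using f by (intro exI[of _ "cpoly f"]) simp
    then obtain p where p: "poly (cpoly p) c = 0" "\<And>g. poly (cpoly g) c = 0 \<Longrightarrow> p dvd g"
        "\<And>g. (\<And>i. coeff g i \<in> \<rat>) \<Longrightarrow> poly g c = 0 \<Longrightarrow> cpoly p dvd g"
      by (elim int_minimal_poly) blast
    have "p dvd f" using p(2) \<open>poly (cpoly f) c = 0\<close> by blast
    then obtain h where h: "f = p * h" by (elim dvdE)
    have dvd_t: "cpoly p dvd monom 1 L - [:t:]"
      using c ab(2) \<open>t \<in> \<rat>\<close> by (intro p(3)) (auto simp: poly_monom t_def coeff_pCons split: nat.split)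
    have sub: "r \<in> {a, b}" if r: "poly (cpoly p) r = 0" for r
    proof -
      have "r ^ L = t" using r dvd_t by (auto elim!: dvdE simp: poly_monom dest!: arg_cong[of _ _ "\<lambda>q. poly q r"])
      moreover have "r \<in> set xs" using r unfolding set_xs h by (simp add: cpoly_mult)
      ultimately show ?thesis using dist set_ys by auto
    qed
    \<comment> \<open>Minimality gives a simple root only at c. At the other root simplicity is
      inherited from f, whose roots are pairwise distinct; \<open>zs\<close> lists them with r left
      out.\<close>
    have simple: "poly (pderiv (cpoly p)) r \<noteq> 0" if r: "poly (cpoly p) r = 0" for r
    proof
      assume "poly (pderiv (cpoly p)) r = 0"
      then have f': "poly (pderiv (cpoly f)) r = 0"
        using r by (simp add: h cpoly_mult pderiv_mult)
      define zs where "zs = (if r = a then b else a) # ys"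
      have "mset (a # b # ys) = mset (r # zs)" using sub[OF r] by (auto simp: zs_def)
      then have "cpoly f = smult (of_int (lead_coeff f)) (monic_of_roots (r # zs))"
        unfolding xs xs_eq by (metis monic_of_roots_mset_cong)
      then have "poly (monic_of_roots zs) r = 0"
        using f' f by (simp add: pderiv_smult pderiv_monic_of_roots_eq del: monic_of_roots_simps)
      moreover have "r ^ L = t" using sub[OF r] ab(2) by (auto simp: t_def)
      then have "r \<notin> set zs" using dist sub[OF r] ab(1) by (auto simp: zs_def)
      ultimately show False by simp
    qed
    have "\<forall>S. {r. poly (cpoly p) r = 0} = S \<longrightarrow>
          cpoly p = smult (of_int (lead_coeff p)) (\<Prod>r\<in>S. [:- r, 1:])"
      using poly_eq_prod_simple_roots[of "cpoly p"] simple by (metis coeff_cpoly degree_cpoly)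
    then show ?thesis using \<open>p dvd f\<close> p(1,2) sub by blast
  qed
  obtain p where p: "p dvd f" "poly (cpoly p) a = 0" "{r. poly (cpoly p) r = 0} \<subseteq> {a, b}"
    "\<And>S. {r. poly (cpoly p) r = 0} = S \<Longrightarrow> cpoly p = smult (of_int (lead_coeff p)) (\<Prod>r\<in>S. [:- r, 1:])"
    using min_poly[of a] by blast
  obtain q where q: "q dvd f" "poly (cpoly q) b = 0" "\<And>g. poly (cpoly g) b = 0 \<Longrightarrow> q dvd g"
    "{r. poly (cpoly q) r = 0} \<subseteq> {a, b}"
    "\<And>S. {r. poly (cpoly q) r = 0} = S \<Longrightarrow> cpoly q = smult (of_int (lead_coeff q)) (\<Prod>r\<in>S. [:- r, 1:])"
    using min_poly[of b] by blast
  have pair: "(\<Prod>r\<in>{a, b}. [:- r, 1:]) = [:- a, 1:] * [:- b, 1:]"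
    using ab(1) by (simp del: mult_pCons_left)
  consider "{r. poly (cpoly p) r = 0} = {a, b}" | "{r. poly (cpoly q) r = 0} = {a, b}"
    | "{r. poly (cpoly p) r = 0} = {a}" "{r. poly (cpoly q) r = 0} = {b}"
    using p(2,3) q(2,4) by blast
  then show thesis
  proof cases
    case 1
    from p(4)[OF 1] p(1) show thesis unfolding pair by (elim dvdE) (rule that)
  next
    case 2
    from q(5)[OF 2] q(1) show thesis unfolding pair by (elim dvdE) (rule that)
  next
    \<comment> \<open>Both a and b are rational here. Their linear polynomials have different roots,
      so the second one divides the cofactor of the first.\<close>
    case 3
    obtain h where h: "f = p * h" using p(1) by (elim dvdE)
    have "poly (cpoly p) b \<noteq> 0" using 3(1) ab(1) by auto
    then have "poly (cpoly h) b = 0" using roots(2) by (simp add: h cpoly_mult)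
    from q(3)[OF this] obtain v where v: "h = q * v" by (elim dvdE)
    have "cpoly p = smult (of_int (lead_coeff p)) [:- a, 1:]" "cpoly q = smult (of_int (lead_coeff q)) [:- b, 1:]"
      using p(4)[OF 3(1)] q(5)[OF 3(2)] by simp_all
    then have "cpoly (p * q) = smult (of_int (lead_coeff (p * q))) ([:- a, 1:] * [:- b, 1:])"
      unfolding cpoly_mult lead_coeff_mult of_int_mult
      by (metis mult_smult_left mult_smult_right smult_smult)
    with h v that[of "p * q" v] show thesis by (simp add: mult.assoc)
  qed
qed

text \<open>Synthetic division by X - r, run in the direction in which errors do not grow: from the
  constant term upwards if |r| >= 1, from the top downwards if |r| < 1. Every step costs one B. The
  two bounds together say that the cofactor times max(1, |r|) is no larger than n B.\<close>

lemma norm_coeff_linear_cofactor_le: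
  fixes q :: "complex poly"
  assumes B: "\<And>k. norm (coeff ([:- r, 1:] * q) k) \<le> B" and deg: "degree ([:- r, 1:] * q) \<le> n"
  shows "norm (coeff q k) \<le> real n * B" "norm (r * coeff q k) \<le> real n * B"
proof -
  have "B \<ge> 0" using B[of 0] norm_ge_zero order_trans by blast
  have zero: "coeff q k = 0" if "k \<ge> n" for k
  proof (cases "q = 0")
    case False
    then have "degree ([:- r, 1:] * q) = Suc (degree q)"
      by (subst degree_mult_eq) auto
    then show ?thesis using deg that by (intro coeff_eq_0) simp
  qed simp
  have rec: "coeff ([:- r, 1:] * q) (Suc k) = coeff q k - r * coeff q (Suc k)"
    and rec0: "coeff ([:- r, 1:] * q) 0 = - r * coeff q 0" for k
    by simp_all
  have "norm (coeff q k) \<le> real n * B \<and> norm (r * coeff q k) \<le> real n * B" for k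
  proof (cases "norm r \<ge> 1")
    case True
    have *: "norm (r * coeff q k) \<le> real (Suc k) * B" for k
    proof (induction k)
      case 0
      then show ?case using B[of 0] unfolding rec0 by simp
    next
      case (Suc k)
      have "norm (coeff q k) \<le> norm (r * coeff q k)"
        using True by (simp add: norm_mult mult_right_le_one_le mult_le_cancel_right1)
      moreover have "norm (r * coeff q (Suc k)) \<le> norm (coeff q k) + B"
        using B[of "Suc k"] norm_triangle_sub[of "r * coeff q (Suc k)" "coeff q k"]
        unfolding rec by (simp add: norm_minus_commute)
      ultimately show ?case using Suc by (simp add: algebra_simps)
    qed
    have r: "norm (r * coeff q k) \<le> real n * B"
    proof (cases "k < n")
      case True
      have "real (Suc k) * B \<le> real n * B" using True \<open>B \<ge> 0\<close> by (intro mult_right_mono) auto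
      with *[of k] show ?thesis by linarith
    qed (use zero \<open>B \<ge> 0\<close> in simp)
    moreover have "norm (coeff q k) \<le> norm (r * coeff q k)"
      using True by (simp add: norm_mult mult_le_cancel_right1)
    ultimately show ?thesis by linarith
  next
    case False
    have *: "norm (coeff q (n - j)) \<le> real j * B" if "j \<le> n" for j
      using that
    proof (induction j)
      case 0
      then show ?case using zero[of n] by simp
    next
      case (Suc j)
      have S: "Suc (n - Suc j) = n - j" using Suc.prems by simp
      have "norm (r * coeff q (n - j)) \<le> norm (coeff q (n - j))"
        using False by (simp add: norm_mult mult_left_le_one_le)
      moreover have "norm (coeff q (n - Suc j)) \<le> norm (r * coeff q (n - j)) + B"
        using B[of "n - j"] norm_triangle_sub[of "coeff q (n - Suc j)" "r * coeff q (n - j)"]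
        using rec[of "n - Suc j"] unfolding S by simp
      ultimately show ?case using Suc by (simp add: algebra_simps)
    qed
    have q: "norm (coeff q k) \<le> real n * B"
    proof (cases "k < n")
      case True
      have "real (n - k) * B \<le> real n * B" using \<open>B \<ge> 0\<close> by (intro mult_right_mono) auto
      with *[of "n - k"] True show ?thesis by simp
    qed (use zero \<open>B \<ge> 0\<close> in simp)
    moreover have "norm (r * coeff q k) \<le> norm (coeff q k)"
      using False by (simp add: norm_mult mult_left_le_one_le)
    ultimately show ?thesis by linarith
  qed
  then show "norm (coeff q k) \<le> real n * B" "norm (r * coeff q k) \<le> real n * B" by blast+
qed

text \<open>X - a and X - b are divided out one after the other, each at the cost of a factor n.
  Without the weights a and b this bounds \<open>lead_coeff U\<close> times v; with both weights it
  bounds \<open>lead_coeff U\<close> * a * b = \<open>coeff U 0\<close> times v.\<close>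

lemma quadratic_cofactor_bound:
  fixes U v :: "int poly" and a b :: complex
  assumes U: "cpoly U = smult (of_int (lead_coeff U)) ([:- a, 1:] * [:- b, 1:])"
    and H: "\<And>k. \<bar>coeff (U * v) k\<bar> \<le> int H" and deg: "degree (U * v) \<le> n"
  shows "\<bar>lead_coeff U * coeff v k\<bar> \<le> int (n * n * H)" "\<bar>coeff U 0 * coeff v k\<bar> \<le> int (n * n * H)"
proof -
  define \<alpha> :: complex where "\<alpha> = of_int (lead_coeff U)"
  define q where "q = [:- b, 1:] * smult \<alpha> (cpoly v)"
  have f_eq: "cpoly (U * v) = [:- a, 1:] * q"
    unfolding cpoly_mult U q_def \<alpha>_def by (simp only: mult_smult_left mult_smult_right mult.assoc)
  have deg_q: "degree ([:- a, 1:] * q) \<le> n" using deg unfolding f_eq[symmetric] by simp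
  have "norm (coeff ([:- a, 1:] * q) k) \<le> real H" for k
    using H[of k] unfolding f_eq[symmetric] coeff_cpoly norm_of_int by linarith
  note 1 = norm_coeff_linear_cofactor_le[OF this deg_q]
  have deg_q': "degree q \<le> n"
    using deg_q by (cases "q = 0") (auto simp: degree_mult_eq simp del: mult_pCons_left)
  have 2: "norm (coeff (smult \<alpha> (cpoly v)) k) \<le> real n * (real n * real H)"
    using 1(1) deg_q' unfolding q_def by (rule norm_coeff_linear_cofactor_le(1))
  have aq: "[:- b, 1:] * smult (a * \<alpha>) (cpoly v) = smult a q"
    unfolding q_def by (simp only: mult_smult_right smult_smult)
  have 3: "norm (b * coeff (smult (a * \<alpha>) (cpoly v)) k) \<le> real n * (real n * real H)"
  proof (rule norm_coeff_linear_cofactor_le(2))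
    show "norm (coeff ([:- b, 1:] * smult (a * \<alpha>) (cpoly v)) k) \<le> real n * real H" for k
      unfolding aq using 1(2)[of k] by simp
    show "degree ([:- b, 1:] * smult (a * \<alpha>) (cpoly v)) \<le> n"
      unfolding aq using deg_q' degree_smult_le le_trans by blast
  qed
  have "coeff (cpoly U) 0 = \<alpha> * (a * b)" unfolding U \<alpha>_def by simp
  then have \<gamma>: "of_int (coeff U 0) = \<alpha> * (a * b)" by simp
  have bound: "\<bar>x\<bar> \<le> int (n * n * H)" if "norm (of_int x :: complex) \<le> real n * (real n * real H)" for x
  proof -
    have "real_of_int \<bar>x\<bar> \<le> real_of_int (int (n * n * H))" using that by (simp add: norm_of_int mult.assoc)
    then show ?thesis by linarith
  qed
  show "\<bar>lead_coeff U * coeff v k\<bar> \<le> int (n * n * H)" using 2 by (intro bound) (simp add: \<alpha>_def)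
  show "\<bar>coeff U 0 * coeff v k\<bar> \<le> int (n * n * H)"
    using 3 by (intro bound) (simp add: \<gamma> mult_ac)
qed

text \<open>From a * b = \<gamma> / \<alpha> and a^L = b^L it follows that a^(2L) = b^(2L) =
  (\<gamma> / \<alpha>)^L, so a and b each range over 2L values.\<close>

lemma card_quadratics_le:
  fixes \<alpha> \<gamma> :: int
  assumes "\<alpha> \<noteq> 0" "\<gamma> \<noteq> 0" "L > 0"
  defines "A \<equiv> {U. lead_coeff U = \<alpha> \<and> coeff U 0 = \<gamma> \<and>
    (\<exists>a b. a ^ L = b ^ L \<and> cpoly U = smult (of_int \<alpha>) ([:- a, 1:] * [:- b, 1:]))}"
  shows "finite A" "card A \<le> (2 * L) ^ 2"
proof -
  define Z where "Z = {z::complex. z ^ (2 * L) = (of_int \<gamma> / of_int \<alpha>) ^ L}"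
  have Z: "finite Z" "card Z = 2 * L"
    using assms card_nth_roots[of "(of_int \<gamma> / of_int \<alpha>) ^ L" "2 * L"] unfolding Z_def
    by (auto intro!: card_ge_0_finite)
  let ?g = "\<lambda>(a, b). smult (of_int \<alpha>) ([:- a, 1:] * [:- b, 1:] :: complex poly)"
  have sub: "cpoly ` A \<subseteq> ?g ` (Z \<times> Z)"
  proof safe
    fix U assume "U \<in> A"
    then obtain a b where U: "coeff U 0 = \<gamma>" "a ^ L = b ^ L"
        "cpoly U = smult (of_int \<alpha>) ([:- a, 1:] * [:- b, 1:])" by (auto simp: A_def)
    have "coeff (cpoly U) 0 = of_int \<alpha> * (a * b)" unfolding U(3) by simp
    then have "a * b = of_int \<gamma> / of_int \<alpha>" using assms(1) U(1) by (simp add: field_simps)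
    then have "(of_int \<gamma> / of_int \<alpha>) ^ L = a ^ L * b ^ L" by (metis power_mult_distrib)
    then have "a \<in> Z" "b \<in> Z" using U(2) by (simp_all add: Z_def power_add mult_2)
    then show "cpoly U \<in> ?g ` (Z \<times> Z)" using U(3) by (auto intro!: image_eqI[of _ _ "(a, b)"])
  qed
  have inj: "inj_on cpoly A" by (auto intro: inj_onI simp: cpoly_eq_iff)
  have fin: "finite (?g ` (Z \<times> Z))" using Z by blast
  then show "finite A" using sub inj finite_subset finite_imageD by metis
  have "card A = card (cpoly ` A)" using inj by (simp add: card_image)
  also have "\<dots> \<le> card (?g ` (Z \<times> Z))" using fin sub by (rule card_mono)
  also have "\<dots> \<le> card (Z \<times> Z)" using Z by (intro card_image_le) blast
  also have "\<dots> = (2 * L) ^ 2" using Z by (simp add: power2_eq_square)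
  finally show "card A \<le> (2 * L) ^ 2" .
qed

lemma card_max_abs_le:
  fixes m :: nat
  defines "Q \<equiv> {(\<alpha>::int, \<gamma>::int). max \<bar>\<alpha>\<bar> \<bar>\<gamma>\<bar> = int m}"
  shows "finite Q" "m > 0 \<Longrightarrow> card Q \<le> 12 * m"
proof -
  let ?X = "{int m, - int m}" and ?Y = "{- int m..int m}"
  have sub: "Q \<subseteq> ?X \<times> ?Y \<union> ?Y \<times> ?X" unfolding Q_def by auto
  then show "finite Q" by (rule finite_subset) auto
  assume "m > 0"
  have "card Q \<le> card (?X \<times> ?Y \<union> ?Y \<times> ?X)" using sub by (intro card_mono) auto
  also have "\<dots> \<le> card (?X \<times> ?Y) + card (?Y \<times> ?X)" by (rule card_Un_le)
  also have "\<dots> = 4 * (2 * m + 1)" using \<open>m > 0\<close> by (simp add: card_cartesian_product nat_add_distrib)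
  also have "\<dots> \<le> 12 * m" using \<open>m > 0\<close> by simp
  finally show "card Q \<le> 12 * m" .
qed

lemma card_multiples_of_quadratics_le:
  fixes n L :: nat
  assumes "n \<ge> 2" "L > 0"
  obtains C where "C > 0" "\<And>H. real (card {f. f \<noteq> 0 \<and> degree f = n \<and> (\<forall>k. \<bar>coeff f k\<bar> \<le> int H) \<and>
      (\<exists>U v a b. f = U * v \<and> a ^ L = b ^ L \<and> a \<noteq> 0 \<and> b \<noteq> 0 \<and>
        cpoly U = smult (of_int (lead_coeff U)) ([:- a, 1:] * [:- b, 1:]))})
    \<le> C * (\<Sum>m=1..n * n * H. real m * (real (n * n * H) / real m) ^ (n - 1))"
proof -
  \<comment> \<open>There are at most 12 m pairs of outer coefficients with maximum m, at most
    (2L)^2 quadratics for each pair, and 2x + 1 <= 3x holds for x = N div m >= 1 in each of the n -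
    1 coefficients of v.\<close>
  define C where "C = real (12 * (2 * L) ^ 2 * 3 ^ (n - 1))"
  show thesis
  proof (rule that[of C])
    show "C > 0" using assms by (simp add: C_def)
    fix H :: nat
    define N where "N = n * n * H"
    define A where "A = {f. f \<noteq> 0 \<and> degree f = n \<and> (\<forall>k. \<bar>coeff f k\<bar> \<le> int H) \<and>
      (\<exists>U v a b. f = U * v \<and> a ^ L = b ^ L \<and> a \<noteq> 0 \<and> b \<noteq> 0 \<and>
        cpoly U = smult (of_int (lead_coeff U)) ([:- a, 1:] * [:- b, 1:]))}"
    define Q where "Q m = {(\<alpha>::int, \<gamma>::int). max \<bar>\<alpha>\<bar> \<bar>\<gamma>\<bar> = int m}" for m
    define UU where "UU \<alpha> \<gamma> = {U. \<alpha> \<noteq> 0 \<and> \<gamma> \<noteq> 0 \<and> lead_coeff U = \<alpha> \<and> coeff U 0 = \<gamma> \<and>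
      (\<exists>a b. a ^ L = b ^ L \<and> cpoly U = smult (of_int \<alpha>) ([:- a, 1:] * [:- b, 1:]))}"
      for \<alpha> \<gamma> :: int
    define VV where "VV m = {v::int poly. degree v \<le> n - 2 \<and> (\<forall>k. \<bar>coeff v k\<bar> \<le> int (N div m))}" for m
    define F where "F m = (\<lambda>(U, v). U * v) ` ((\<Union>(\<alpha>, \<gamma>)\<in>Q m. UU \<alpha> \<gamma>) \<times> VV m)" for m
    have UU: "finite (UU \<alpha> \<gamma>)" "card (UU \<alpha> \<gamma>) \<le> (2 * L) ^ 2" for \<alpha> \<gamma>
      using card_quadratics_le[of \<alpha> \<gamma> L] assms(2) unfolding UU_def
      by (cases "\<alpha> = 0 \<or> \<gamma> = 0"; auto)+
    have VV: "finite (VV m)" "card (VV m) \<le> (2 * (N div m) + 1) ^ (n - 1)" for m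
      using card_int_polys_le[of "n - 2" "N div m"] assms(1)
      by (simp_all add: VV_def Suc_diff_Suc numeral_2_eq_2)
    have finF: "finite (F m)" for m
      unfolding F_def using UU(1) VV(1) card_max_abs_le(1)[of m]
      by (auto simp: Q_def)
    have card_F: "real (card (F m)) \<le> C * (real m * (real N / real m) ^ (n - 1))" if m: "m \<in> {1..N}" for m
    proof -
      have "card (\<Union>(\<alpha>, \<gamma>)\<in>Q m. UU \<alpha> \<gamma>) \<le> (\<Sum>(\<alpha>, \<gamma>)\<in>Q m. card (UU \<alpha> \<gamma>))"
        using card_UN_le[of "Q m" "\<lambda>(\<alpha>, \<gamma>). UU \<alpha> \<gamma>"] card_max_abs_le(1)[of m]
        by (simp add: Q_def case_prod_beta)
      also have "\<dots> \<le> (\<Sum>_\<in>Q m. (2 * L) ^ 2)" using UU(2) by (intro sum_mono) auto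
      also have "\<dots> \<le> 12 * m * (2 * L) ^ 2"
        using card_max_abs_le(2)[of m] m by (simp add: Q_def)
      finally have U: "card (\<Union>(\<alpha>, \<gamma>)\<in>Q m. UU \<alpha> \<gamma>) \<le> 12 * m * (2 * L) ^ 2" .
      have "N div m \<ge> 1" using m by (simp add: Suc_leI div_greater_zero_iff)
      then have "card (VV m) \<le> (3 * (N div m)) ^ (n - 1)"
        by (intro order_trans[OF VV(2)] power_mono) auto
      then have "real (card (VV m)) \<le> real (3 * (N div m)) ^ (n - 1)" by (metis of_nat_le_iff of_nat_power)
      also have "\<dots> \<le> (3 * (real N / real m)) ^ (n - 1)"
        using of_nat_div_le_of_nat[of N m, where 'a = real] by (intro power_mono) auto
      finally have V: "real (card (VV m)) \<le> 3 ^ (n - 1) * (real N / real m) ^ (n - 1)"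
        by (simp only: power_mult_distrib)
      have "card (F m) \<le> card (\<Union>(\<alpha>, \<gamma>)\<in>Q m. UU \<alpha> \<gamma>) * card (VV m)"
        unfolding F_def card_cartesian_product[symmetric]
        using UU(1) VV(1) card_max_abs_le(1)[of m] by (intro card_image_le) (auto simp: Q_def)
      then have "real (card (F m)) \<le> real (card (\<Union>(\<alpha>, \<gamma>)\<in>Q m. UU \<alpha> \<gamma>)) * real (card (VV m))"
        by (metis of_nat_le_iff of_nat_mult)
      also have "\<dots> \<le> real (12 * m * (2 * L) ^ 2) * (3 ^ (n - 1) * (real N / real m) ^ (n - 1))"
        using U V by (intro mult_mono) (auto simp only: of_nat_le_iff intro: of_nat_0_le_iff)
      also have "\<dots> = C * (real m * (real N / real m) ^ (n - 1))" by (simp add: C_def)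
      finally show ?thesis .
    qed
    have "A \<subseteq> (\<Union>m\<in>{1..N}. F m)"
    proof
      fix f assume "f \<in> A"
      then obtain U v a b where f: "f \<noteq> 0" "degree f = n" "\<And>k. \<bar>coeff f k\<bar> \<le> int H"
        and Uv: "f = U * v" "a ^ L = b ^ L" "a \<noteq> 0" "b \<noteq> 0"
          "cpoly U = smult (of_int (lead_coeff U)) ([:- a, 1:] * [:- b, 1:])"
        unfolding A_def by blast
      have "U \<noteq> 0" "v \<noteq> 0" using f(1) Uv(1) by auto
      define \<alpha> where "\<alpha> = lead_coeff U"
      define \<gamma> where "\<gamma> = coeff U 0"
      have "\<alpha> \<noteq> 0" using \<open>U \<noteq> 0\<close> by (simp add: \<alpha>_def)
      have "coeff (cpoly U) 0 \<noteq> 0" unfolding Uv(5) using \<open>U \<noteq> 0\<close> Uv(3,4) by simp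
      then have "\<gamma> \<noteq> 0" by (simp add: \<gamma>_def)
      have "degree (cpoly U) = degree (smult (of_int \<alpha>) ([:- a, 1:] * [:- b, 1:] :: complex poly))"
        using Uv(5) by (simp only: \<alpha>_def)
      then have "degree U = 2" using \<open>\<alpha> \<noteq> 0\<close> by simp
      then have deg_v: "degree v \<le> n - 2" using f(2) \<open>U \<noteq> 0\<close> \<open>v \<noteq> 0\<close> by (simp add: Uv(1) degree_mult_eq)
      define m where "m = nat (max \<bar>\<alpha>\<bar> \<bar>\<gamma>\<bar>)"
      have m: "int m = max \<bar>\<alpha>\<bar> \<bar>\<gamma>\<bar>" "m > 0" using \<open>\<alpha> \<noteq> 0\<close> by (auto simp: m_def)
      have "\<bar>\<alpha> * coeff v k\<bar> \<le> int N" "\<bar>\<gamma> * coeff v k\<bar> \<le> int N" for k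
        using quadratic_cofactor_bound[OF Uv(5), of v H n k] f unfolding Uv(1)[symmetric]
        by (simp_all add: \<alpha>_def \<gamma>_def N_def)
      then have mv: "int m * \<bar>coeff v k\<bar> \<le> int N" for k
        unfolding m(1) max_def by (simp add: abs_mult)
      have v_bound: "\<bar>coeff v k\<bar> \<le> int (N div m)" for k
        using zdiv_mono1[OF mv[of k], of "int m"] m(2) by (simp add: zdiv_int)
      \<comment> \<open>A nonzero integer coefficient of v forces m <= N, so the sum over m may stop
        at N.\<close>
      have "1 \<le> \<bar>lead_coeff v\<bar>" using \<open>v \<noteq> 0\<close> by (metis abs_ge_zero abs_eq_0 leading_coeff_0_iff linorder_not_le order_antisym zless_imp_add1_zle add_0)
      then have "int m * 1 \<le> int N" by (rule order_trans[OF mult_left_mono mv]) simp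
      then have "m \<in> {1..N}" using m(2) by simp
      moreover have "(\<alpha>, \<gamma>) \<in> Q m" using m by (simp add: Q_def)
      moreover have "U \<in> UU \<alpha> \<gamma>"
        using Uv \<open>\<alpha> \<noteq> 0\<close> \<open>\<gamma> \<noteq> 0\<close> unfolding UU_def \<alpha>_def \<gamma>_def by blast
      moreover have "v \<in> VV m" using deg_v v_bound by (simp add: VV_def)
      ultimately show "f \<in> (\<Union>m\<in>{1..N}. F m)" unfolding F_def Uv(1) by blast
    qed
    then have "card A \<le> card (\<Union>m\<in>{1..N}. F m)" using finF by (intro card_mono) auto
    also have "\<dots> \<le> (\<Sum>m=1..N. card (F m))" by (intro card_UN_le) simp
    finally have "real (card A) \<le> (\<Sum>m=1..N. real (card (F m)))" by (metis of_nat_le_iff of_nat_sum)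
    also have "\<dots> \<le> (\<Sum>m=1..N. C * (real m * (real N / real m) ^ (n - 1)))"
      using card_F by (rule sum_mono)
    also have "\<dots> = C * (\<Sum>m=1..N. real m * (real N / real m) ^ (n - 1))"
      by (rule sum_distrib_left[symmetric])
    finally show "real (card {f. f \<noteq> 0 \<and> degree f = n \<and> (\<forall>k. \<bar>coeff f k\<bar> \<le> int H) \<and>
        (\<exists>U v a b. f = U * v \<and> a ^ L = b ^ L \<and> a \<noteq> 0 \<and> b \<noteq> 0 \<and>
          cpoly U = smult (of_int (lead_coeff U)) ([:- a, 1:] * [:- b, 1:]))})
      \<le> C * (\<Sum>m=1..n * n * H. real m * (real (n * n * H) / real m) ^ (n - 1))"
      by (simp only: A_def N_def)
  qed
qed

section \<open>The upper bounds\<close>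

lemma harmonic_sum_ge_ln: "ln (real N + 1) \<le> (\<Sum>m=1..N. 1 / real m)"
proof (induction N)
  case (Suc N)
  have "ln (real (Suc N) + 1) - ln (real N + 1) = ln (1 + 1 / (real N + 1))"
  proof -
    have "1 + 1 / (real N + 1) = (real (Suc N) + 1) / (real N + 1)" by (simp add: field_simps)
    then show ?thesis by (simp add: ln_div)
  qed
  also have "\<dots> \<le> 1 / (real N + 1)" by (rule ln_add_one_self_le_self) simp
  finally show ?case using Suc by (simp add: algebra_simps)
qed simp

lemma harmonic_sum_le_ln: "N > 0 \<Longrightarrow> (\<Sum>m=1..N. 1 / real m) \<le> 1 + ln (real N)"
proof (induction N rule: nat_induct_non_zero)
  case (Suc N)
  have "ln (real N / (real N + 1)) \<le> real N / (real N + 1) - 1"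
    using Suc(1) by (intro ln_le_minus_one) simp
  also have "\<dots> = - 1 / (real N + 1)" by (simp add: field_simps)
  finally have "1 / (real N + 1) \<le> ln (real N + 1) - ln (real N)"
    using Suc(1) by (simp add: ln_div)
  then show ?case using Suc by (simp add: add.commute)
qed simp

text \<open>Comparison with the telescoping series of 1 / (m (m - 1)). The starting point is
  variable because the upper bound uses k = 1, while the density of coprime pairs needs the sharper
  tail from k = 2.\<close>

lemma sum_inverse_squares_le:
  assumes "k > 0"
  shows "(\<Sum>m=Suc k..N. 1 / real m ^ 2) \<le> 1 / real k"
proof -
  have "(\<Sum>m=Suc k..N. 1 / real m ^ 2) \<le> 1 / real k - 1 / real N" if "k \<le> N" for N
    using that
  proof (induction N rule: dec_induct)
    case (step N)
    have "1 / real (Suc N) ^ 2 \<le> 1 / (real N * real (Suc N))"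
      using assms step(1) by (intro divide_left_mono) (auto simp: power2_eq_square)
    also have "\<dots> = 1 / real N - 1 / real (Suc N)"
      using assms step(1) by (simp add: field_simps)
    finally show ?case using step by simp
  qed simp
  note * = this[of N]
  show ?thesis
  proof (cases "k \<le> N")
    case True
    have "1 / real N \<ge> 0" by simp
    then show ?thesis using *[OF True] by linarith
  qed simp
qed

text \<open>The summand equals N^(n-1) m^(2-n), so the exponents 0, -1 and at most -2 of m separate
  the three cases.\<close>

lemma sum_weighted_powers_le:
  fixes n N :: nat
  assumes "N > 0"
  defines "G \<equiv> \<Sum>m=1..N. real m * (real N / real m) ^ (n - 1)"
  shows "n = 2 \<Longrightarrow> G \<le> real N ^ 2"
    and "n = 3 \<Longrightarrow> G \<le> real N ^ 2 * (1 + ln (real N))"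
    and "n \<ge> 4 \<Longrightarrow> G \<le> 2 * real N ^ (n - 1)"
proof -
  show "G \<le> real N ^ 2" if "n = 2"
    unfolding G_def that by (simp add: power2_eq_square)
  show "G \<le> real N ^ 2 * (1 + ln (real N))" if "n = 3"
  proof -
    have "G = (\<Sum>m=1..N. real N ^ 2 * (1 / real m))"
      unfolding G_def that by (intro sum.cong) (auto simp: field_simps power2_eq_square)
    also have "\<dots> = real N ^ 2 * (\<Sum>m=1..N. 1 / real m)" by (simp only: sum_distrib_left)
    also have "\<dots> \<le> real N ^ 2 * (1 + ln (real N))"
      using harmonic_sum_le_ln[OF assms(1)] by (intro mult_left_mono) auto
    finally show ?thesis .
  qed
  show "G \<le> 2 * real N ^ (n - 1)" if "n \<ge> 4"
  proof -
    have n: "n - 1 = Suc (n - 2)" using that by simp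
    have "G \<le> (\<Sum>m=1..N. real N ^ (n - 1) * (1 / real m ^ 2))"
      unfolding G_def
    proof (rule sum_mono)
      fix m assume m: "m \<in> {1..N}"
      have "real m * (real N / real m) ^ (n - 1) = real N ^ (n - 1) * (1 / real m ^ (n - 2))"
        using m unfolding n by (simp add: power_divide)
      also have "\<dots> \<le> real N ^ (n - 1) * (1 / real m ^ 2)"
        using m that by (intro mult_left_mono divide_left_mono power_increasing) auto
      finally show "real m * (real N / real m) ^ (n - 1) \<le> real N ^ (n - 1) * (1 / real m ^ 2)" .
    qed
    also have "\<dots> = real N ^ (n - 1) * (\<Sum>m=1..N. 1 / real m ^ 2)" by (simp only: sum_distrib_left)
    also have "(\<Sum>m=1..N. 1 / real m ^ 2) = 1 + (\<Sum>m=Suc 1..N. 1 / real m ^ 2)"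
      using assms(1) by (subst sum.atLeast_Suc_atMost) auto
    also have "real N ^ (n - 1) * \<dots> \<le> real N ^ (n - 1) * 2"
      using sum_inverse_squares_le[of 1 N] by (intro mult_left_mono) auto
    finally show ?thesis by simp
  qed
qed

lemma S_star_bounds:
  assumes "f \<in> S_star n H" "n > 0"
  shows "f \<noteq> 0" "degree f = n" "\<bar>coeff f k\<bar> \<le> int H"
    "\<exists>x y. x \<noteq> y \<and> poly (cpoly f) x = 0 \<and> poly (cpoly f) y = 0 \<and> y \<noteq> 0 \<and> root_of_unity (x / y)"
proof -
  show deg: "degree f = n" using assms by (simp add: S_star_def)
  with assms(2) show "f \<noteq> 0" by auto
  have "\<forall>j\<le>n. \<bar>coeff f (n - j)\<bar> \<le> int H" using assms by (simp add: S_star_def)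
  from this[rule_format, of "n - k"] deg show "\<bar>coeff f k\<bar> \<le> int H"
    by (cases "k \<le> n") (auto simp: coeff_eq_0)
  have "y \<noteq> 0" if "root_of_unity (x / y)" for x y
    using that by (auto simp: root_of_unity_def zero_power)
  then show "\<exists>x y. x \<noteq> y \<and> poly (cpoly f) x = 0 \<and> poly (cpoly f) y = 0 \<and> y \<noteq> 0 \<and> root_of_unity (x / y)"
    using assms(1) unfolding S_star_def degenerate_def by blast
qed

lemma D_star_upper:
  assumes "n \<ge> 2"
  obtains C where "C > 0" "\<And>H. H \<ge> 1 \<Longrightarrow> real (D_star n H) \<le>
    C * (real H ^ (n - 1) + (\<Sum>m=1..n * n * H. real m * (real (n * n * H) / real m) ^ (n - 1)))"
proof -
  obtain L where L: "L > 0" "\<And>f x y. f \<noteq> 0 \<Longrightarrow> degree f = n \<Longrightarrow> poly (cpoly f) x = 0 \<Longrightarrow>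
    poly (cpoly f) y = 0 \<Longrightarrow> root_of_unity (x / y) \<Longrightarrow> (x / y) ^ L = 1"
    using uniform_exponent[of n] by blast
  let ?S = "\<lambda>H. {f. f \<noteq> 0 \<and> degree f = n \<and> (\<forall>k. \<bar>coeff f k\<bar> \<le> int H) \<and>
      card ((\<lambda>x. x ^ L) ` {x. poly (cpoly f) x = 0}) \<le> n - 2}"
  let ?T = "\<lambda>H. {f. f \<noteq> 0 \<and> degree f = n \<and> (\<forall>k. \<bar>coeff f k\<bar> \<le> int H) \<and>
      (\<exists>U v a b. f = U * v \<and> a ^ L = b ^ L \<and> a \<noteq> 0 \<and> b \<noteq> 0 \<and>
        cpoly U = smult (of_int (lead_coeff U)) ([:- a, 1:] * [:- b, 1:]))}"
  let ?G = "\<lambda>H. \<Sum>m=1..n * n * H. real m * (real (n * n * H) / real m) ^ (n - 1)"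
  obtain K where K: "\<And>H. H > 0 \<Longrightarrow> card (?S H) \<le> K * H ^ (n - 2 + 1)"
    using card_few_root_powers_le[OF L(1), of n "n - 2"] by blast
  obtain C where C: "C > 0" "\<And>H. real (card (?T H)) \<le> C * ?G H"
    using card_multiples_of_quadratics_le[OF assms L(1)] by blast
  show thesis
  proof (rule that[of "real K + C"])
    show "real K + C > 0" using C(1) by simp
    fix H :: nat assume "H \<ge> 1"
    have "S_star n H \<subseteq> ?S H \<union> ?T H"
    proof
      fix f assume "f \<in> S_star n H"
      note f = S_star_bounds[OF this]
      have "n > 0" using assms by simp
      note f = f[OF this]
      from f(4) obtain a b where ab: "a \<noteq> b" "poly (cpoly f) a = 0" "poly (cpoly f) b = 0" "b \<noteq> 0"
          "root_of_unity (a / b)" by blast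
      have "(a / b) ^ L = 1" using L(2)[OF f(1,2) ab(2,3,5)] .
      then have pow: "a ^ L = b ^ L" using ab(4) by (simp add: power_divide)
      have "a \<noteq> 0" using \<open>(a / b) ^ L = 1\<close> L(1) by (auto simp: zero_power)
      show "f \<in> ?S H \<union> ?T H"
      proof (cases "card ((\<lambda>x. x ^ L) ` {x. poly (cpoly f) x = 0}) \<le> n - 2")
        case True
        then show ?thesis using f by blast
      next
        case False
        then have "degree f \<le> card ((\<lambda>x. x ^ L) ` {x. poly (cpoly f) x = 0}) + 1"
          using f(2) by linarith
        from unique_pair_quadratic_factor[OF f(1) L(1) ab(1) pow ab(2,3) this] obtain U v
          where "f = U * v" "cpoly U = smult (of_int (lead_coeff U)) ([:- a, 1:] * [:- b, 1:])" by blast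
        then show ?thesis using f pow ab(4) \<open>a \<noteq> 0\<close> by blast
      qed
    qed
    moreover have "finite (?S H \<union> ?T H)"
      using card_int_polys_le(1)[of n H] by (rule finite_subset[rotated]) auto
    ultimately have "D_star n H \<le> card (?S H \<union> ?T H)" unfolding D_star_def by (intro card_mono)
    also have "\<dots> \<le> card (?S H) + card (?T H)" by (rule card_Un_le)
    finally have "real (D_star n H) \<le> real (card (?S H)) + real (card (?T H))" by linarith
    also have "real (card (?S H)) \<le> real (K * H ^ (n - 2 + 1))"
      using K[of H] \<open>H \<ge> 1\<close> by (intro of_nat_mono) simp
    also have "real (K * H ^ (n - 2 + 1)) = real K * real H ^ (n - 1)"
      using assms by (simp add: Suc_diff_Suc numeral_2_eq_2)
    finally have "real (D_star n H) \<le> real K * real H ^ (n - 1) + C * ?G H" using C(2)[of H] by linarith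
    also have "\<dots> \<le> (real K + C) * (real H ^ (n - 1) + ?G H)"
    proof -
      have "?G H \<ge> 0" by (intro sum_nonneg) simp
      then have "C * real H ^ (n - 1) \<ge> 0" "real K * ?G H \<ge> 0" using C(1) by simp_all
      then show ?thesis by (simp only: distrib_left distrib_right)
    qed
    finally show "real (D_star n H) \<le> (real K + C) * (real H ^ (n - 1) + ?G H)" .
  qed
qed

lemma D_star_upper_bounds:
  assumes "n \<ge> 2"
  obtains C where "C > 0" "\<And>H. H \<ge> 2 \<Longrightarrow> n = 2 \<Longrightarrow> real (D_star n H) \<le> C * real H ^ 2"
    "\<And>H. H \<ge> 2 \<Longrightarrow> n = 3 \<Longrightarrow> real (D_star n H) \<le> C * (real H ^ 2 * ln (real H))"
    "\<And>H. H \<ge> 2 \<Longrightarrow> n \<ge> 4 \<Longrightarrow> real (D_star n H) \<le> C * real H ^ (n - 1)"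
proof -
  obtain C0 where C0: "C0 > 0" "\<And>H. H \<ge> 1 \<Longrightarrow> real (D_star n H) \<le>
    C0 * (real H ^ (n - 1) + (\<Sum>m=1..n * n * H. real m * (real (n * n * H) / real m) ^ (n - 1)))"
    using D_star_upper[OF assms] by blast
  let ?G = "\<lambda>H. \<Sum>m=1..n * n * H. real m * (real (n * n * H) / real m) ^ (n - 1)"
  \<comment> \<open>The first term is the bound 2 N^(n-1) for N = n^2 H. The number 2000 serves
    small n: for n = 3, ln 9 <= 8 and ln H >= 1/2 give 1 + 81 (1 + ln 9 + ln H) <= 1541 ln H, where
    81 comes from N = 9 H.\<close>
  define C where "C = C0 * (2 * real (n * n) ^ (n - 1) + 2000)"
  have G_pos: "n * n * H > 0" if "H \<ge> 2" for H using that assms by simp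
  show thesis
  proof (rule that[of C])
    show "C > 0" using C0(1) by (simp add: C_def add_nonneg_pos)
    fix H :: nat assume H: "H \<ge> 2"
    have D: "real (D_star n H) \<le> C0 * (real H ^ (n - 1) + ?G H)" using C0(2) H by simp
    show "real (D_star n H) \<le> C * real H ^ 2" if "n = 2"
    proof -
      have "real H ^ (n - 1) \<le> real H ^ 2" using H that by (simp add: power2_eq_square)
      moreover have "?G H \<le> 16 * real H ^ 2"
        using sum_weighted_powers_le(1)[OF G_pos[OF H] that] by (simp add: that power_mult_distrib)
      moreover have "(2 * real (n * n) ^ (n - 1) + 2000) * real H ^ 2 \<ge> 17 * real H ^ 2"
        by (intro mult_right_mono) (auto simp: that)
      ultimately have "real H ^ (n - 1) + ?G H \<le> (2 * real (n * n) ^ (n - 1) + 2000) * real H ^ 2" by linarith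
      from order_trans[OF D mult_left_mono[OF this]] C0(1) show ?thesis by (simp add: C_def mult.assoc)
    qed
    show "real (D_star n H) \<le> C * (real H ^ 2 * ln (real H))" if "n = 3"
    proof -
      have half: "1 / 2 \<le> ln (real H)"
      proof -
        have "1 / 2 \<le> ln (2::real)" using ln_le_minus_one[of "1/2::real"] by (simp add: ln_div)
        also have "\<dots> \<le> ln (real H)" using H by simp
        finally show ?thesis .
      qed
      have ln9: "ln (9::real) \<le> 8" using ln_le_minus_one[of "9::real"] by simp
      have "?G H \<le> real (9 * H) ^ 2 * (1 + ln (real (9 * H)))"
        using sum_weighted_powers_le(2)[OF G_pos[OF H] that] by (simp add: that)
      also have "\<dots> = real H ^ 2 * (81 * (1 + ln 9 + ln (real H)))"
        using H by (simp add: ln_mult power_mult_distrib algebra_simps)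
      finally have "real H ^ (n - 1) + ?G H \<le> real H ^ 2 * (1 + 81 * (1 + ln 9 + ln (real H)))"
        by (simp add: that algebra_simps)
      also have "\<dots> \<le> real H ^ 2 * ((2 * real (n * n) ^ (n - 1) + 2000) * ln (real H))"
      proof (rule mult_left_mono)
        have "2 * real (n * n) ^ (n - 1) + 2000 = 2162" by (simp add: that)
        then show "1 + 81 * (1 + ln 9 + ln (real H)) \<le> (2 * real (n * n) ^ (n - 1) + 2000) * ln (real H)"
          using half ln9 by (simp add: algebra_simps)
      qed simp
      finally have "real H ^ (n - 1) + ?G H \<le> (2 * real (n * n) ^ (n - 1) + 2000) * (real H ^ 2 * ln (real H))"
        by (simp only: mult_ac)
      from order_trans[OF D mult_left_mono[OF this]] C0(1) show ?thesis by (simp add: C_def mult.assoc)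
    qed
    show "real (D_star n H) \<le> C * real H ^ (n - 1)" if "n \<ge> 4"
    proof -
      have "?G H \<le> 2 * real (n * n) ^ (n - 1) * real H ^ (n - 1)"
        using sum_weighted_powers_le(3)[OF G_pos[OF H] that] by (simp add: power_mult_distrib mult_ac)
      then have "real H ^ (n - 1) + ?G H \<le> (2 * real (n * n) ^ (n - 1) + 1) * real H ^ (n - 1)"
        by (simp add: distrib_right)
      also have "\<dots> \<le> (2 * real (n * n) ^ (n - 1) + 2000) * real H ^ (n - 1)"
        by (intro mult_right_mono) auto
      finally show ?thesis
        using order_trans[OF D mult_left_mono] C0(1) by (simp add: C_def mult.assoc)
    qed
  qed
qed

section \<open>The lower bounds\<close>

text \<open>The roots z and -z of a X^2 + b are nonzero and have quotient -1.\<close>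

lemma degenerate_multiple_of_even_quadratic:
  fixes a b :: int
  assumes "a \<noteq> 0" "b \<noteq> 0"
  shows "degenerate (cpoly ([:b, 0, a:] * g))"
proof -
  define z where "z = csqrt (- of_int b / of_int a)"
  have z2: "z ^ 2 = - of_int b / of_int a" by (simp add: z_def)
  then have "z \<noteq> 0" using assms by auto
  have "poly (cpoly [:b, 0, a:]) w = of_int b + of_int a * w ^ 2" for w
    by (simp add: map_poly_pCons power2_eq_square algebra_simps)
  then have root: "poly (cpoly [:b, 0, a:]) w = 0" if "w ^ 2 = z ^ 2" for w
    using that z2 assms by (simp add: field_simps)
  show ?thesis unfolding degenerate_def
  proof (intro exI conjI)
    show "z \<noteq> - z" using \<open>z \<noteq> 0\<close> by simp
    show "poly (cpoly ([:b, 0, a:] * g)) z = 0" "poly (cpoly ([:b, 0, a:] * g)) (- z) = 0"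
      using root[of z] root[of "- z"] unfolding cpoly_mult poly_mult by simp_all
    show "root_of_unity (z / - z)"
      using \<open>z \<noteq> 0\<close> by (auto simp: root_of_unity_def intro!: exI[of _ 2])
  qed
qed

lemma S_starI:
  assumes "degree f = n" "degenerate (cpoly f)" "\<And>k. \<bar>coeff f k\<bar> \<le> int H"
  shows "f \<in> S_star n H"
  using assms by (simp add: S_star_def)

lemma card_le_D_star:
  assumes "inj_on \<phi> A" "\<phi> ` A \<subseteq> S_star n H"
  shows "card A \<le> D_star n H"
  unfolding D_star_def using assms finite_S_star by (rule card_inj_on_le)

lemma D_star_2_lower: "H ^ 2 \<le> D_star 2 H"
proof -
  \<comment> \<open>The factor 1 presents the quadratic as a multiple of itself, the form for which
    degeneracy was shown.\<close>
  let ?\<phi> = "\<lambda>(a, b). [:int b, 0, int a:] * 1"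
  have "card ({1..H} \<times> {1..H}) \<le> D_star 2 H"
  proof (rule card_le_D_star[of ?\<phi>])
    show "inj_on ?\<phi> ({1..H} \<times> {1..H})" by (auto simp: inj_on_def)
    show "?\<phi> ` ({1..H} \<times> {1..H}) \<subseteq> S_star 2 H"
    proof safe
      fix a b assume ab: "a \<in> {1..H}" "b \<in> {1..H}"
      show "[:int b, 0, int a:] * 1 \<in> S_star 2 H"
      proof (rule S_starI)
        show "degenerate (cpoly ([:int b, 0, int a:] * 1))"
          using ab by (intro degenerate_multiple_of_even_quadratic) auto
      qed (use ab in \<open>auto simp: coeff_pCons split: nat.split\<close>)
    qed
  qed
  then show ?thesis by (simp add: power2_eq_square)
qed

lemma D_star_lower:
  assumes "n \<ge> 2"
  shows "(H div 2) ^ (n - 1) \<le> D_star n H"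
proof -
  \<comment> \<open>A coefficient of (X^2 + 1) g is a sum of at most two coefficients of g, hence
    the half. Entries start at 1 so that the last one is nonzero and the list is recovered from its
    polynomial.\<close>
  let ?M = "int (H div 2)"
  let ?T = "{xs. set xs \<subseteq> {1..?M} \<and> length xs = n - 1}"
  let ?\<phi> = "\<lambda>xs. [:1, 0, 1:] * Poly xs"
  have coeffs: "coeffs (Poly xs) = xs" if "xs \<in> ?T" for xs
  proof -
    have "xs \<noteq> []" using that assms by auto
    then have "last xs \<noteq> 0" using that last_in_set by fastforce
    then show ?thesis by (simp add: strip_while_idem_iff no_trailing_unfold)
  qed
  have "card ?T \<le> D_star n H"
  proof (rule card_le_D_star[of ?\<phi>])
    show "inj_on ?\<phi> ?T"
    proof (rule inj_onI)
      fix xs ys assume "xs \<in> ?T" "ys \<in> ?T" "?\<phi> xs = ?\<phi> ys"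
      then have "Poly xs = Poly ys" by (subst (asm) mult_cancel_left) simp
      then show "xs = ys" using coeffs \<open>xs \<in> ?T\<close> \<open>ys \<in> ?T\<close> by metis
    qed
    show "?\<phi> ` ?T \<subseteq> S_star n H"
    proof (rule image_subsetI)
      fix xs assume xs: "xs \<in> ?T"
      show "[:1, 0, 1:] * Poly xs \<in> S_star n H"
      proof (rule S_starI)
        have "xs \<noteq> []" using xs assms by auto
        then have "Poly xs \<noteq> 0" using coeffs[OF xs] by (metis coeffs_eq_Nil)
        have "degree (Poly xs) = n - 2"
          unfolding degree_eq_length_coeffs coeffs[OF xs] using xs by auto
        then have "degree ([:1, 0, 1:] * Poly xs) = 2 + (n - 2)"
          using \<open>Poly xs \<noteq> 0\<close> by (subst degree_mult_eq) auto
        then show "degree ([:1, 0, 1:] * Poly xs) = n" using assms by simp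
        show "degenerate (cpoly ([:1, 0, 1:] * Poly xs))"
          by (rule degenerate_multiple_of_even_quadratic) simp_all
        have b: "coeff (Poly xs) k \<in> {0..?M}" for k
        proof (cases "k < length xs")
          case True
          then have "xs ! k \<in> {1..?M}" using xs nth_mem by blast
          then show ?thesis using True by (simp add: nth_default_nth)
        qed (simp add: nth_default_beyond)
        have "coeff ([:1, 0, 1:] * Poly xs) k
            = coeff (Poly xs) k + (if k \<ge> 2 then coeff (Poly xs) (k - 2) else 0)" for k
          by (auto simp: coeff_pCons numeral_2_eq_2 split: nat.split)
        then show "\<bar>coeff ([:1, 0, 1:] * Poly xs) k\<bar> \<le> int H" for k
          using b[of k] b[of "k - 2"] by (auto simp del: coeff_Poly_eq)
      qed
    qed
  qed
  also have "card ?T = (H div 2) ^ (n - 1)"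
    by (subst card_lists_length_eq) simp_all
  finally show ?thesis .
qed

text \<open>All other pairs share a divisor g >= 2, and there are at most (K/g)^2 of them for each
  g. Since 1/4 + 1/9 + 1/16 + ... <= 1/4 + 1/2, at least a quarter of the pairs remains.\<close>

lemma card_coprime_pairs_ge:
  "real K ^ 2 / 4 \<le> real (card {(a, b). a \<in> {1..K} \<and> b \<in> {1..K} \<and> coprime a b})"
proof -
  define P where "P = {(a, b). a \<in> {1..K} \<and> b \<in> {1..K} \<and> coprime a b}"
  define M where "M g = {a\<in>{1..K}. g dvd a}" for g
  have "finite P" unfolding P_def by (rule finite_subset[of _ "{1..K} \<times> {1..K}"]) auto
  have card_M: "card (M g) \<le> K div g" if "g > 0" for g
  proof -
    have "M g \<subseteq> (*) g ` {1..K div g}"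
    proof
      fix a assume "a \<in> M g"
      then obtain j where "a = g * j" "a \<in> {1..K}" by (auto simp: M_def)
      with that show "a \<in> (*) g ` {1..K div g}"
        by (auto simp: less_eq_div_iff_mult_less_eq mult.commute)
    qed
    then have "card (M g) \<le> card ((*) g ` {1..K div g})" by (intro card_mono) auto
    also have "\<dots> \<le> K div g" using card_image_le[of "{1..K div g}" "(*) g"] by simp
    finally show ?thesis .
  qed
  have "{1..K} \<times> {1..K} \<subseteq> P \<union> (\<Union>g\<in>{2..K}. M g \<times> M g)"
  proof safe
    fix a b assume ab: "a \<in> {1..K}" "b \<in> {1..K}" "(a, b) \<notin> (\<Union>g\<in>{2..K}. M g \<times> M g)"
    show "(a, b) \<in> P"
    proof (rule ccontr)
      assume "(a, b) \<notin> P"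
      then have "gcd a b \<noteq> 1" using ab by (simp add: P_def coprime_iff_gcd_eq_1)
      moreover have "gcd a b \<noteq> 0" "gcd a b \<le> a" using ab by (auto intro: gcd_le1_nat)
      moreover have "a \<le> K" using ab(1) by simp
      ultimately have "gcd a b \<in> {2..K}" unfolding atLeastAtMost_iff by linarith
      moreover have "(a, b) \<in> M (gcd a b) \<times> M (gcd a b)" using ab by (simp add: M_def)
      ultimately show False using ab(3) by blast
    qed
  qed
  moreover have "finite (P \<union> (\<Union>g\<in>{2..K}. M g \<times> M g))" using \<open>finite P\<close> by (auto simp: M_def)
  ultimately have "card ({1..K} \<times> {1..K}) \<le> card (P \<union> (\<Union>g\<in>{2..K}. M g \<times> M g))" by (rule card_mono[rotated])
  also have "\<dots> \<le> card P + card (\<Union>g\<in>{2..K}. M g \<times> M g)" by (rule card_Un_le)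
  also have "card (\<Union>g\<in>{2..K}. M g \<times> M g) \<le> (\<Sum>g=2..K. card (M g \<times> M g))"
    by (rule card_UN_le) simp
  also have "\<dots> \<le> (\<Sum>g=2..K. (K div g) ^ 2)"
    using card_M by (intro sum_mono) (auto simp: card_cartesian_product power2_eq_square intro!: mult_mono)
  finally have "K ^ 2 \<le> card P + (\<Sum>g=2..K. (K div g) ^ 2)" by (simp add: power2_eq_square)
  then have "real K ^ 2 \<le> real (card P) + (\<Sum>g=2..K. real (K div g) ^ 2)"
    by (metis (mono_tags, lifting) of_nat_add of_nat_le_iff of_nat_power of_nat_sum sum.cong)
  also have "(\<Sum>g=2..K. real (K div g) ^ 2) \<le> (\<Sum>g=2..K. real K ^ 2 * (1 / real g ^ 2))"
  proof (rule sum_mono)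
    fix g
    have "real (K div g) ^ 2 \<le> (real K / real g) ^ 2"
      by (intro power_mono of_nat_div_le_of_nat) simp
    then show "real (K div g) ^ 2 \<le> real K ^ 2 * (1 / real g ^ 2)" by (simp add: power_divide)
  qed
  also have "\<dots> = real K ^ 2 * (\<Sum>g=2..K. 1 / real g ^ 2)" by (simp only: sum_distrib_left)
  also have "\<dots> \<le> real K ^ 2 * (3 / 4)"
  proof (rule mult_left_mono)
    show "(\<Sum>g=2..K. 1 / real g ^ 2) \<le> 3 / 4"
    proof (cases "K \<ge> 2")
      case True
      then have "(\<Sum>g=2..K. 1 / real g ^ 2) = 1 / 4 + (\<Sum>g=Suc 2..K. 1 / real g ^ 2)"
        by (subst sum.atLeast_Suc_atMost) auto
      then show ?thesis using sum_inverse_squares_le[of 2 K] by simp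
    qed simp
  qed simp
  finally show ?thesis by (simp add: P_def)
qed

text \<open>Coprimality of a and b makes the factorization unique: c is the gcd of the coefficients
  a c and b c of the product. For fixed c there are c choices of d and on the order of (H/c)^2
  choices of (a, b), so the count is a harmonic sum times H^2.\<close>

lemma D_star_3_lower: "real H ^ 2 * ln (real H) / 16 \<le> real (D_star 3 H)"
proof -
  define P where "P K = {(a, b). a \<in> {1..K} \<and> b \<in> {1..K} \<and> coprime a b}" for K :: nat
  define A where "A = Sigma {1..H} (\<lambda>c. {1..c} \<times> P (H div c))"
  have finP: "finite (P K)" for K
    unfolding P_def by (rule finite_subset[of _ "{1..K} \<times> {1..K}"]) auto
  let ?\<phi> = "\<lambda>(c, d, a, b). [:int b, 0, int a:] * [:int d, int c:]"
  have expand: "[:int b, 0, int a:] * [:int d, int c:] = [:int (b * d), int (b * c), int (a * d), int (a * c):]"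
    for a b c d by (simp add: mult.commute)
  have "card A \<le> D_star 3 H"
  proof (rule card_le_D_star[of ?\<phi>])
    show "inj_on ?\<phi> A"
    proof (rule inj_onI)
      fix x y assume "x \<in> A" "y \<in> A" and eq: "?\<phi> x = ?\<phi> y"
      obtain c d a b c' d' a' b' where xy: "x = (c, d, a, b)" "y = (c', d', a', b')"
        by (metis prod_cases4)
      have pos: "c > 0" "a > 0" "coprime a b" "coprime a' b'"
        using \<open>x \<in> A\<close> \<open>y \<in> A\<close> by (auto simp: xy A_def P_def)
      have eqs: "b * d = b' * d'" "b * c = b' * c'" "a * d = a' * d'" "a * c = a' * c'"
        using eq unfolding xy prod.case expand by (simp_all only: pCons_eq_iff of_nat_eq_iff)
      have "c = gcd (c * a) (c * b)" "c' = gcd (c' * a') (c' * b')"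
        using pos by (simp_all flip: gcd_mult_distrib_nat add: coprime_iff_gcd_eq_1)
      then have "c = c'" using eqs by (metis mult.commute)
      then have "a = a'" "b = b'" using eqs pos by auto
      then show "x = y" using eqs pos \<open>c = c'\<close> by (auto simp: xy)
    qed
    show "?\<phi> ` A \<subseteq> S_star 3 H"
    proof (rule image_subsetI)
      fix x assume "x \<in> A"
      obtain c d a b where x: "x = (c, d, a, b)" by (metis prod_cases4)
      have c: "1 \<le> c" "c \<le> H" "1 \<le> d" "d \<le> c" "1 \<le> a" "a \<le> H div c" "1 \<le> b" "b \<le> H div c"
        using \<open>x \<in> A\<close> by (auto simp: x A_def P_def)
      have "u * v \<le> H" if "u \<le> H div c" "v \<le> c" for u v
        using mult_le_mono[OF that] div_times_less_eq_dividend[of H c] by linarith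
      then have "b * d \<le> H" "b * c \<le> H" "a * d \<le> H" "a * c \<le> H" using c by auto
      then have "\<bar>coeff [:int (b * d), int (b * c), int (a * d), int (a * c):] k\<bar> \<le> int H" for k
        by (auto simp: coeff_pCons split: nat.split simp flip: of_nat_mult)
      moreover have "degree [:int (b * d), int (b * c), int (a * d), int (a * c):] = 3"
        using c by simp
      ultimately show "?\<phi> x \<in> S_star 3 H"
        using c degenerate_multiple_of_even_quadratic[of "int a" "int b" "[:int d, int c:]"]
        unfolding x prod.case expand by (intro S_starI) auto
    qed
  qed
  moreover have "card A = (\<Sum>c=1..H. c * card (P (H div c)))"
    unfolding A_def using finP by (subst card_SigmaI) (auto simp: card_cartesian_product)
  ultimately have "(\<Sum>c=1..H. real c * real (card (P (H div c)))) \<le> real (D_star 3 H)"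
    by (simp flip: of_nat_mult of_nat_sum)
  moreover have "real H ^ 2 / 16 * (1 / real c) \<le> real c * real (card (P (H div c)))" if c: "c \<in> {1..H}" for c
  proof -
    \<comment> \<open>Rounding down costs at most a factor 2, that is, H / (2c) <= H div c. Squaring
      gives 1/4, and the proportion of coprime pairs gives another 1/4, hence the 16.\<close>
    have "H div c \<ge> 1" using c by (simp add: Suc_leI div_greater_zero_iff)
    then have "c \<le> (H div c) * c" by simp
    moreover have "H < c + (H div c) * c" using c by (intro dividend_less_div_times) simp
    ultimately have "H \<le> 2 * (H div c) * c" by linarith
    then have "real H \<le> real (2 * (H div c) * c)" by (rule of_nat_mono)
    then have "real H / (2 * real c) \<le> real (H div c)" using c by (simp add: field_simps)
    then have "(real H / (2 * real c)) ^ 2 / 4 \<le> real (H div c) ^ 2 / 4"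
      by (intro divide_right_mono power_mono) auto
    also have "\<dots> \<le> real (card (P (H div c)))" using card_coprime_pairs_ge by (simp add: P_def)
    finally have "real c * ((real H / (2 * real c)) ^ 2 / 4) \<le> real c * real (card (P (H div c)))"
      by (intro mult_left_mono) auto
    moreover have "real c * ((real H / (2 * real c)) ^ 2 / 4) = real H ^ 2 / 16 * (1 / real c)"
      using c by (simp add: field_simps power2_eq_square)
    ultimately show ?thesis by simp
  qed
  then have "(\<Sum>c=1..H. real H ^ 2 / 16 * (1 / real c)) \<le> (\<Sum>c=1..H. real c * real (card (P (H div c))))"
    by (rule sum_mono)
  moreover have "real H ^ 2 / 16 * ln (real H) \<le> real H ^ 2 / 16 * (\<Sum>c=1..H. 1 / real c)"
  proof (cases "H = 0")
    case False
    then have "ln (real H) \<le> ln (real H + 1)" by simp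
    also have "\<dots> \<le> (\<Sum>c=1..H. 1 / real c)" by (rule harmonic_sum_ge_ln)
    finally show ?thesis by (intro mult_left_mono) auto
  qed simp
  ultimately show ?thesis by (simp add: sum_distrib_left)
qed

theorem theorem1p4:
  fixes n :: nat
  assumes "n \<ge> 2"
  shows "\<exists>c C :: real. c > 0 \<and> C > 0 \<and>
    (\<forall>H::nat. H \<ge> 2 \<longrightarrow>
      (n = 2 \<longrightarrow> c * real H ^ 2 \<le> real (D_star n H) \<and>
                real (D_star n H) \<le> C * real H ^ 2) \<and>
      (n = 3 \<longrightarrow> c * (real H ^ 2 * ln (real H)) \<le> real (D_star n H) \<and>
                real (D_star n H) \<le> C * (real H ^ 2 * ln (real H))) \<and>
      (n \<ge> 4 \<longrightarrow> c * real H ^ (n - 1) \<le> real (D_star n H) \<and>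
                real (D_star n H) \<le> C * real H ^ (n - 1)))"
proof -
  obtain C where C: "C > 0" "\<And>H. H \<ge> 2 \<Longrightarrow> n = 2 \<Longrightarrow> real (D_star n H) \<le> C * real H ^ 2"
    "\<And>H. H \<ge> 2 \<Longrightarrow> n = 3 \<Longrightarrow> real (D_star n H) \<le> C * (real H ^ 2 * ln (real H))"
    "\<And>H. H \<ge> 2 \<Longrightarrow> n \<ge> 4 \<Longrightarrow> real (D_star n H) \<le> C * real H ^ (n - 1)"
    using D_star_upper_bounds[OF assms] by blast
  \<comment> \<open>For n >= 4 the base 1/3 comes from H <= 3 * (H div 2), valid for H >= 2 with
    equality at H = 3.\<close>
  define c :: real where "c = (if n = 2 then 1 else if n = 3 then 1 / 16 else (1 / 3) ^ (n - 1))"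
  have "c * real H ^ 2 \<le> real (D_star n H)" if "n = 2" for H
    using D_star_2_lower[of H] that by (simp add: c_def flip: of_nat_power)
  moreover have "c * (real H ^ 2 * ln (real H)) \<le> real (D_star n H)" if "n = 3" for H
    using D_star_3_lower[of H] that by (simp add: c_def)
  moreover have "c * real H ^ (n - 1) \<le> real (D_star n H)" if "n \<ge> 4" "H \<ge> 2" for H
  proof -
    have "H \<le> 3 * (H div 2)" using that(2) by presburger
    then have "real H \<le> real (3 * (H div 2))" by (rule of_nat_mono)
    then have "1 / 3 * real H \<le> real (H div 2)" by simp
    then have "(1 / 3 * real H) ^ (n - 1) \<le> real (H div 2) ^ (n - 1)" by (intro power_mono) auto
    also have "\<dots> \<le> real (D_star n H)"
      using D_star_lower[OF assms, of H] by (simp flip: of_nat_power)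
    finally show ?thesis using that(1) by (simp add: c_def power_mult_distrib power_divide)
  qed
  moreover have "c > 0" by (simp add: c_def)
  ultimately show ?thesis using C by blast
qed

end
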